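(* Fix constants $\delta,\alpha\in(0,1)$, $L>0$, let $\varphi:[-1,1]\to[0,\infty)$ be a given $L$-Lipschitz convex surrogate, and let $$\kappa=4\sqrt{2}\,L\sqrt{\log\left(\frac{2M}{\delta}\right)}.$$ Assume that there exists a positive constant $\varepsilon<1$ such that $\mathcal{H}^{\varphi,\varepsilon\alpha}$ is nonempty. Let $\bar\varepsilon$ be the smallest $\varepsilon\ge 0$ such that $\mathcal{H}^{\varphi,\varepsilon\alpha}\neq\emptyset$, let $n_0$ be the smallest integer such that $$n_0\ge\left(\frac{4\kappa}{(1-\bar\varepsilon)\alpha}\right)^2,$$ and assume $n^-\ge n_0$. Let $\tilde h^\kappa$ denote any solution to $$\min_{h\in\mathcal{H}^{\mathrm{conv}},\ \hat R_\varphi^-(h)\le\alpha-\kappa/\sqrt{n^-}}\hat R_\varphi^+(h).$$ Then, with probability at least $1-2\delta$, the following hold simultaneously: $$R^-(\tilde h^\kappa)\le R_\varphi^-(\tilde h^\kappa)\le\alpha$$ and $$R_\varphi^+(\tilde h^\kappa)-\min_{h\in\mathcal{H}^{\varphi,\alpha}}R_\varphi^+(h)\le\frac{4\varphi(1)\kappa}{(1-\bar\varepsilon)\alpha\sqrt{n^-}}+\frac{2\kappa}{\sqrt{n^+}}.$$ In particular, as $M$, $n^-$ and $n^+$ all go to infinity and the other quantities are held fixed, the last bound yields $$R_\varphi^+(\tilde h^\kappa)-\min_{h\in\mathcal{H}^{\varphi,\alpha}}R_\varphi^+(h)=\mathcal{O}\left(\sqrt{\frac{\log M}{n^-}}+\sqrt{\frac{\log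 M}{n^+}}\right).$$
   Context: A convex surrogate is a function $\varphi:[-1,1]\to[0,\infty)$ that is non-decreasing, continuous and convex with $\varphi(0)=1$. Let $\mathcal{X}\subset\mathbb{R}^d$, and let $(X,Y)$ be a random pair with $X\in\mathcal{X}$ and $Y\in\{-1,1\}$; $P^-$ and $P^+$ denote the conditional distributions of $X$ given $Y=-1$ and $Y=1$. A classifier is a (measurable) map $h:\mathcal{X}\to[-1,1]$. Let $h_1,\dots,h_M$, $M\ge2$, be fixed classifiers, let $\Lambda=\{\lambda\in\mathbb{R}^M:\lambda_j\ge0,\ \sum_{j=1}^M\lambda_j=1\}$, $\mathsf{h}_\lambda=\sum_{j=1}^M\lambda_jh_j$, and $\mathcal{H}^{\mathrm{conv}}=\{\mathsf{h}_\lambda:\lambda\in\Lambda\}$. Errors: $R^-(h)=P^-(h(X)\ge0)$ (type I error), $R_\varphi^-(h)=\mathbb{E}_{X\sim P^-}[\varphi(h(X))]$ ($\varphi$-type I error), $R_\varphi^+(h)=\mathbb{E}_{X\sim P^+}[\varphi(-h(X))]$ ($\varphi$-type II error). One observes an i.i.d. sample $X_1^-,\dots,X_{n^-}^-$ from $P^-$ and an i.i.d. sample $X_1^+,\dots,X_{n^+}^+$ from $P^+$, with deterministic $n^-,n^+\ge1$; the two samples are not assumed to be mutually independent. The empirical errors are $\hat R_\varphi^-(h)=\frac1{n^-}\sum_{i=1}^{n^-}\varphi(h(X_i^-))$ and $\hat R_\varphi^+(h)=\frac1{n^+}\sum_{i=1}^{n^+}\varphi(-h(X_i^+))$. For $a\ge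 0$, $\mathcal{H}^{\varphi,a}=\{h\in\mathcal{H}^{\mathrm{conv}}:R_\varphi^-(h)\le a\}$. *)

theory Defs
  imports "HOL-Probability.Probability"
begin

(* A surrogate is a function on [-1,1]; its values elsewhere are irrelevant. *)
definition convex_surrogate :: "(real \<Rightarrow> real) \<Rightarrow> bool" where
  "convex_surrogate \<phi> \<longleftrightarrow>
     (\<forall>t\<in>{-1..1}. 0 \<le> \<phi> t) \<and> mono_on {-1..1} \<phi> \<and> continuous_on {-1..1} \<phi> \<and>
     convex_on {-1..1} \<phi> \<and> \<phi> 0 = 1"

(* Conditional distribution of X given Y = y, for an event of positive probability.
   The measurable space is DD with the trace of the Borel sets, so DD itself may be any set. *)
definition class_law ::
  "'q measure \<Rightarrow> (real^'d) set \<Rightarrow> ('q \<Rightarrow> real^'d) \<Rightarrow> ('q \<Rightarrow> int) \<Rightarrow> int \<Rightarrow> (real^'d) measure" where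
  "class_law Q DD X Y y =
     distr (uniform_measure Q {q \<in> space Q. Y q = y}) (restrict_space borel DD) X"

definition iid_sample ::
  "'w measure \<Rightarrow> 'a measure \<Rightarrow> nat \<Rightarrow> (nat \<Rightarrow> 'w \<Rightarrow> 'a) \<Rightarrow> bool" where
  "iid_sample W P n Z \<longleftrightarrow>
     prob_space.indep_vars W (\<lambda>_. P) Z {1..n} \<and> (\<forall>i\<in>{1..n}. distr W P (Z i) = P)"

(* The pair (X, Y) lives on Q, the two samples live on W; nothing is assumed about the
   joint law of the two samples. The classifiers are h 1, ..., h M. *)
locale np_setting = pair: prob_space Q + data: prob_space W
  for Q :: "'q measure" and W :: "'w measure" +
  fixes DD :: "(real^'d) set" and X :: "'q \<Rightarrow> real^'d" and Y :: "'q \<Rightarrow> int"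
    and M :: nat and h :: "nat \<Rightarrow> real^'d \<Rightarrow> real"
    and nm np :: nat and Xm Xp :: "nat \<Rightarrow> 'w \<Rightarrow> real^'d"
  assumes X_measurable: "X \<in> Q \<rightarrow>\<^sub>M restrict_space borel DD"
    and Y_measurable: "Y \<in> Q \<rightarrow>\<^sub>M count_space {-1, 1}"
    and class_prob_pos: "0 < measure Q {q \<in> space Q. Y q = -1}"
      "0 < measure Q {q \<in> space Q. Y q = 1}"
    and M_ge_2: "2 \<le> M"
    and classifier_measurable: "j \<in> {1..M} \<Longrightarrow> h j \<in> borel_measurable (restrict_space borel DD)"
    and classifier_range: "j \<in> {1..M} \<Longrightarrow> x \<in> DD \<Longrightarrow> h j x \<in> {-1..1}"
    and sample_sizes: "1 \<le> nm" "1 \<le> np"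
    and sample_minus: "iid_sample W (class_law Q DD X Y (-1)) nm Xm"
    and sample_plus: "iid_sample W (class_law Q DD X Y 1) np Xp"

definition simplex_weights :: "nat \<Rightarrow> (nat \<Rightarrow> real) set" where
  "simplex_weights M = {l. (\<forall>j\<in>{1..M}. 0 \<le> l j) \<and> (\<Sum>j=1..M. l j) = 1}"

definition Hconv :: "nat \<Rightarrow> (nat \<Rightarrow> 'a \<Rightarrow> real) \<Rightarrow> ('a \<Rightarrow> real) set" where
  "Hconv M h = (\<lambda>l x. \<Sum>j=1..M. l j * h j x) ` simplex_weights M"

definition type1 :: "'a measure \<Rightarrow> ('a \<Rightarrow> real) \<Rightarrow> real" where
  "type1 P g = measure P {x \<in> space P. 0 \<le> g x}"

definition phi_type1 :: "(real \<Rightarrow> real) \<Rightarrow> 'a measure \<Rightarrow> ('a \<Rightarrow> real) \<Rightarrow> real" where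
  "phi_type1 \<phi> P g = (\<integral>x. \<phi> (g x) \<partial>P)"

definition phi_type2 :: "(real \<Rightarrow> real) \<Rightarrow> 'a measure \<Rightarrow> ('a \<Rightarrow> real) \<Rightarrow> real" where
  "phi_type2 \<phi> P g = (\<integral>x. \<phi> (- g x) \<partial>P)"

(* In the empirical errors, z 1, ..., z n are the observed values of the sample. *)
definition emp_phi_type1 :: "(real \<Rightarrow> real) \<Rightarrow> nat \<Rightarrow> (nat \<Rightarrow> 'a) \<Rightarrow> ('a \<Rightarrow> real) \<Rightarrow> real" where
  "emp_phi_type1 \<phi> n z g = (1 / real n) * (\<Sum>i=1..n. \<phi> (g (z i)))"

definition emp_phi_type2 :: "(real \<Rightarrow> real) \<Rightarrow> nat \<Rightarrow> (nat \<Rightarrow> 'a) \<Rightarrow> ('a \<Rightarrow> real) \<Rightarrow> real" where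
  "emp_phi_type2 \<phi> n z g = (1 / real n) * (\<Sum>i=1..n. \<phi> (- g (z i)))"

definition Hphi ::
  "(real \<Rightarrow> real) \<Rightarrow> 'a measure \<Rightarrow> nat \<Rightarrow> (nat \<Rightarrow> 'a \<Rightarrow> real) \<Rightarrow> real \<Rightarrow> ('a \<Rightarrow> real) set" where
  "Hphi \<phi> P M h a = {g \<in> Hconv M h. phi_type1 \<phi> P g \<le> a}"

definition kappa :: "real \<Rightarrow> nat \<Rightarrow> real \<Rightarrow> real" where
  "kappa L M \<delta> = 4 * sqrt 2 * L * sqrt (ln (2 * real M / \<delta>))"

definition eps_bar ::
  "(real \<Rightarrow> real) \<Rightarrow> 'a measure \<Rightarrow> nat \<Rightarrow> (nat \<Rightarrow> 'a \<Rightarrow> real) \<Rightarrow> real \<Rightarrow> real" where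
  "eps_bar \<phi> P M h \<alpha> = (LEAST \<epsilon>. 0 \<le> \<epsilon> \<and> Hphi \<phi> P M h (\<epsilon> * \<alpha>) \<noteq> {})"

(* The lower bound on n is nonnegative, so the smallest such integer is a natural number. *)
definition n_zero :: "real \<Rightarrow> real \<Rightarrow> real \<Rightarrow> nat" where
  "n_zero \<kappa> \<epsilon> \<alpha> = (LEAST n. (4 * \<kappa> / ((1 - \<epsilon>) * \<alpha>))\<^sup>2 \<le> real n)"

(* The empirical program; zm and zp are the observed values of the two samples. *)
definition np_solution ::
  "(real \<Rightarrow> real) \<Rightarrow> real \<Rightarrow> real \<Rightarrow> nat \<Rightarrow> (nat \<Rightarrow> 'a \<Rightarrow> real) \<Rightarrow>
     nat \<Rightarrow> (nat \<Rightarrow> 'a) \<Rightarrow> nat \<Rightarrow> (nat \<Rightarrow> 'a) \<Rightarrow> ('a \<Rightarrow> real) \<Rightarrow> bool" where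
  "np_solution \<phi> \<kappa> \<alpha> M h nm zm np zp =
     is_arg_min (emp_phi_type2 \<phi> np zp)
       (\<lambda>g. g \<in> Hconv M h \<and> emp_phi_type1 \<phi> nm zm g \<le> \<alpha> - \<kappa> / sqrt (real nm))"

(* Minimum (not merely infimum) of the phi-type II error over the class. *)
definition min_phi_type2 ::
  "(real \<Rightarrow> real) \<Rightarrow> 'a measure \<Rightarrow> ('a \<Rightarrow> real) set \<Rightarrow> real" where
  "min_phi_type2 \<phi> P G = (LEAST v. v \<in> phi_type2 \<phi> P ` G)"

(* The good set need not itself be measurable (it quantifies over uncountably many
   candidate solutions), hence the inner-measure form. *)
definition with_prob_at_least :: "'w measure \<Rightarrow> real \<Rightarrow> ('w \<Rightarrow> bool) \<Rightarrow> bool" where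
  "with_prob_at_least W p A \<longleftrightarrow> (\<exists>E\<in>sets W. p \<le> measure W E \<and> (\<forall>\<omega>\<in>E. A \<omega>))"

end

(* The constant kappa makes sup over Hconv of |empirical - true error| at most kappa / sqrt n with
   probability at least 1 - delta for each sample. To see this, bound the exponential moment of the
   supremum of the centred sums, one observation at a time: convexity symmetrizes, the Lipschitz
   contraction principle replaces phi (h_lambda) by the linear L h_lambda, and a linear function on
   the simplex is maximal at one of the M vertices, which gives the factor M. The constant has a
   factor 2 to spare in the deviation, so it suffices to control a finite net of the simplex; this
   also removes every question of measurability of the supremum.

   On the resulting event a solution is feasible for the true constraint alpha. It is compared with
   the mixture (1 - theta) h* + theta h0 of a best rule h* of level alpha and a rule h0 of level
   eps_bar * alpha, theta = 2 kappa / ((1 - eps_bar) alpha sqrt n), which is feasible for the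
   empirical program and loses at most theta * phi 1. *)

theory Submission
  imports Defs
begin

section \<open>Contraction and symmetrization for exponential moments\<close>

text \<open>Bounding the exponential moment of the supremum directly, instead of its mean followed
  by a concentration inequality, lets the factor M enter once, under the logarithm. With parameter s
  one observation costs a factor exp (2 s^2 L^2): symmetrization by convexity doubles s, and
  averaging over the sign gives cosh (2 s L) <= exp ((2 s L)^2 / 2). The exponent n (2 s^2 L^2 - s
  tau) is least at s = tau / (4 L^2), with value - tau^2 n / (8 L^2). At tau = kappa / (2 sqrt n)
  this is - ln (2 M / delta), which is where the 4 sqrt 2 in kappa comes from.

  The delicate step is contraction. The two signs can have different maximizers, so it becomes an
  inequality about a pair of indices: monotonicity of the surrogate handles one order of the pair,
  the Lipschitz bound the other. The argument is one-sided, so deviations above and below are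
  bounded separately; this gives the 2 in 2 M / delta.\<close>

lemma cosh_le_exp_sq: "(exp x + exp (- x)) / 2 \<le> exp (x\<^sup>2 / 2)" for x :: real
proof -
  have *: "(exp y + exp (- y)) / 2 \<le> exp (y\<^sup>2 / 2)" if "0 \<le> y" for y :: real
  proof -
    \<comment> \<open>Hoeffding's lemma for a fair sign: at probability 1/2 and range 2 y the left
      side is ln (cosh y).\<close>
    have "- (2 * y) * (1 / 2) + ln (1 + (1 / 2) * (exp (2 * y) - 1)) \<le> (2 * y)\<^sup>2 / 8"
      using that by (intro Hoeffdings_lemma_aux) auto
    then have "exp (- y + ln ((1 + exp (2 * y)) / 2)) \<le> exp (y\<^sup>2 / 2)"
      by (simp add: power2_eq_square add_divide_distrib diff_divide_distrib add.commute)
    moreover have "exp (- y + ln ((1 + exp (2 * y)) / 2)) = exp (- y) * ((1 + exp (2 * y)) / 2)"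
      by (subst exp_add, subst exp_ln) (auto intro!: divide_pos_pos add_pos_pos)
    moreover have "exp (- y) * ((1 + exp (2 * y)) / 2) = (exp y + exp (- y)) / 2"
      by (simp add: distrib_left flip: exp_add)
    ultimately show ?thesis by metis
  qed
  show ?thesis
    using *[of x] *[of "- x"] by (cases "0 \<le> x") (auto simp: add.commute)
qed

lemma exp_add_exp_minus_mono:
  fixes p x :: real
  assumes "\<bar>p\<bar> \<le> \<bar>x\<bar>"
  shows "exp p + exp (- p) \<le> exp x + exp (- x)"
proof -
  have "cosh \<bar>p\<bar> \<le> cosh \<bar>x\<bar>"
    using assms by (subst cosh_real_nonneg_le_iff) auto
  moreover have "2 * cosh \<bar>z\<bar> = exp z + exp (- z)" for z :: real
    by (simp add: cosh_def abs_if)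
  ultimately show ?thesis by (metis mult_le_cancel_left_pos zero_less_numeral)
qed

text \<open>To be thought of at one observation: \<open>f\<close> arises from \<open>u\<close> by a
  nondecreasing 1-Lipschitz map that fixes 0. Only values are compared, so that contraction need not
  mention the surrogate; the first clause compares an index with the value 0, the second compares
  two indices.\<close>

definition mono_dominated :: "'t set \<Rightarrow> ('t \<Rightarrow> real) \<Rightarrow> ('t \<Rightarrow> real) \<Rightarrow> bool" where
  "mono_dominated T f u \<longleftrightarrow>
     (\<forall>t\<in>T. 0 \<le> f t \<and> f t \<le> u t \<or> u t \<le> f t \<and> f t \<le> 0) \<and>
     (\<forall>s\<in>T. \<forall>t\<in>T. u s \<le> u t \<longrightarrow> 0 \<le> f t - f s \<and> f t - f s \<le> u t - u s)"

text \<open>A and B stand for the exponential offsets at the maximizers of the two signs, x and y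
  for the values of \<open>u\<close> there, p and q for those of \<open>f\<close>. If x <= y, then p
  <= q allows both terms to be moved to the index of larger weight, and monotonicity of cosh
  finishes. If y < x, the two terms are matched with U and V either straight or crosswise.\<close>

lemma exp_contraction_nonneg:
  fixes A B U V p q x y :: real
  assumes "0 < A" "0 < B" "0 \<le> p" "p \<le> x" "0 \<le> q" "q \<le> y"
    and xy: "x \<le> y \<Longrightarrow> p \<le> q" and yx: "y \<le> x \<Longrightarrow> p - q \<le> x - y"
    and U: "A * exp x \<le> U" "B * exp y \<le> U" and V: "A * exp (- x) \<le> V" "B * exp (- y) \<le> V"
  shows "A * exp p + B * exp (- q) \<le> U + V"
proof (cases "x \<le> y")
  case True
  have pq: "exp (-q) \<le> exp (- p)" "exp p \<le> exp q" using xy[OF True] by auto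
  show ?thesis
  proof (cases "B \<le> A")
    case True
    have "A * exp p + B * exp (- q) \<le> A * exp p + A * exp (- p)"
      using True pq(1) \<open>0 < B\<close> by (intro add_left_mono mult_mono) auto
    also have "\<dots> \<le> A * exp x + A * exp (- x)"
      using exp_add_exp_minus_mono[of p x] assms by (simp flip: distrib_left)
    finally show ?thesis using U V by simp
  next
    case False
    have "A * exp p + B * exp (- q) \<le> B * exp q + B * exp (- q)"
      using False pq(2) \<open>0 < A\<close> by (intro add_right_mono mult_mono) auto
    also have "\<dots> \<le> B * exp y + B * exp (- y)"
      using exp_add_exp_minus_mono[of q y] assms by (simp flip: distrib_left)
    finally show ?thesis using U V by simp
  qed
next
  case False
  show ?thesis
  proof (cases "B * exp (- y) \<le> A * exp p")
    case True
    \<comment> \<open>Straight matching: the drop from B exp (- q) to B exp (- y) is paid for by the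
      rise from A exp p to A exp (p + d), because the same shift d acts on a larger base.\<close>
    define d where "d = y - q"
    have d: "0 \<le> d" "p + d \<le> x" using False yx assms unfolding d_def by auto
    have "B * exp (- q) - B * exp (- y) = B * exp (- y) * (exp d - 1)"
      by (simp add: d_def algebra_simps flip: exp_add)
    also have "\<dots> \<le> A * exp p * (exp d - 1)"
      using True d by (intro mult_right_mono) auto
    also have "\<dots> = A * exp (p + d) - A * exp p" by (simp add: algebra_simps exp_add)
    also have "\<dots> \<le> A * exp x - A * exp p" using d \<open>0 < A\<close> by simp
    finally show ?thesis using U V by simp
  next
    case False
    \<comment> \<open>Crosswise matching: A exp p lies below B exp (- y), hence below V, while B exp
      (- q) fits under U.\<close>
    have "B * exp (- q) \<le> B * exp y" using assms by simp
    then show ?thesis using False U V by simp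
  qed
qed

text \<open>Reflection at 0 exchanges U with V and the two terms with each other, which reduces
  nonpositive values to nonnegative ones. Opposite signs need no comparison between the
  indices.\<close>

lemma exp_contraction:
  fixes A B U V p q x y :: real
  assumes "0 < A" "0 < B"
    and p: "0 \<le> p \<and> p \<le> x \<or> x \<le> p \<and> p \<le> 0" and q: "0 \<le> q \<and> q \<le> y \<or> y \<le> q \<and> q \<le> 0"
    and xy: "x \<le> y \<Longrightarrow> 0 \<le> q - p \<and> q - p \<le> y - x" and yx: "y \<le> x \<Longrightarrow> 0 \<le> p - q \<and> p - q \<le> x - y"
    and U: "A * exp x \<le> U" "B * exp y \<le> U" and V: "A * exp (- x) \<le> V" "B * exp (- y) \<le> V"
  shows "A * exp p + B * exp (- q) \<le> U + V"
proof -
  consider "0 \<le> x" "0 \<le> y" | "x \<le> 0" "y \<le> 0" | "y \<le> 0" "0 \<le> x" | "x \<le> 0" "0 \<le> y" by linarith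
  then show ?thesis
  proof cases
    case 1
    show ?thesis by (rule exp_contraction_nonneg[of A B p x q y]) (use 1 assms in auto)
  next
    case 2
    have "B * exp (- q) + A * exp (- (- p)) \<le> V + U"
      by (rule exp_contraction_nonneg[of B A "- q" "- y" "- p" "- x"]) (use 2 assms in auto)
    then show ?thesis by simp
  next
    case 3
    have "A * exp p \<le> A * exp x" "B * exp (- q) \<le> B * exp (- y)" using 3 p q assms(1,2) by auto
    then show ?thesis using U V by simp
  next
    case 4
    have "A * exp p \<le> A" "B * exp (- q) \<le> B" using 4 p q assms(1,2) by (auto simp: mult_le_cancel_left1)
    \<comment> \<open>Here p <= 0 <= q bounds each term by its weight, and each weight is at most
      the mean of U and V.\<close>
    moreover have "2 * A \<le> A * (exp x + exp (- x))" "2 * B \<le> B * (exp y + exp (- y))"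
      using exp_add_exp_minus_mono[of 0 x] exp_add_exp_minus_mono[of 0 y] assms(1,2) by auto
    ultimately show ?thesis using U V by (simp add: distrib_left)
  qed
qed

section \<open>Exponential of a maximum over a finite index set\<close>

definition max_exp :: "'t set \<Rightarrow> ('t \<Rightarrow> real) \<Rightarrow> real" where
  "max_exp T g = (MAX t\<in>T. exp (g t))"

lemma exp_le_max_exp: "finite T \<Longrightarrow> t \<in> T \<Longrightarrow> exp (g t) \<le> max_exp T g"
  by (simp add: max_exp_def)

lemma max_exp_obtains:
  assumes "finite T" "T \<noteq> {}"
  obtains t where "t \<in> T" "max_exp T g = exp (g t)"
proof -
  have "max_exp T g \<in> (\<lambda>t. exp (g t)) ` T"
    unfolding max_exp_def using assms by (intro Max_in) auto
  then show thesis using that by auto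
qed

lemma max_exp_leI:
  assumes "finite T" "T \<noteq> {}" "\<And>t. t \<in> T \<Longrightarrow> exp (g t) \<le> c"
  shows "max_exp T g \<le> c"
  using assms max_exp_obtains[of T g] by metis

lemma max_exp_nonneg: "finite T \<Longrightarrow> T \<noteq> {} \<Longrightarrow> 0 \<le> max_exp T g"
  using max_exp_obtains[of T g] by (metis exp_ge_zero)

lemma borel_measurable_max_exp [measurable (raw)]:
  assumes "finite T" "\<And>t. t \<in> T \<Longrightarrow> (\<lambda>x. g x t) \<in> borel_measurable M"
  shows "(\<lambda>x. max_exp T (g x)) \<in> borel_measurable M"
  unfolding max_exp_def using assms by measurable

text \<open>Each side is twice an average over a fair sign, and \<open>g\<close> collects the other
  observations. The maximizers s and t on the left may differ, hence the two-index inequality with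
  weights exp (g s) and exp (g t).\<close>

lemma max_exp_contraction:
  assumes T: "finite T" "T \<noteq> {}" and fu: "mono_dominated T f u"
  shows "max_exp T (\<lambda>t. g t + f t) + max_exp T (\<lambda>t. g t - f t)
       \<le> max_exp T (\<lambda>t. g t + u t) + max_exp T (\<lambda>t. g t - u t)" (is "_ \<le> ?U + ?V")
proof -
  have U: "exp (g t) * exp (u t) \<le> ?U" and V: "exp (g t) * exp (- u t) \<le> ?V" if "t \<in> T" for t
    using exp_le_max_exp[OF T(1) that, of "\<lambda>t. g t + u t"] exp_le_max_exp[OF T(1) that, of "\<lambda>t. g t - u t"]
    by (simp_all flip: exp_add)
  have *: "exp (g s) * exp (f s) + exp (g t) * exp (- f t) \<le> ?U + ?V" if "s \<in> T" "t \<in> T" for s t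
    by (rule exp_contraction[of _ _ "f s" "u s" "f t" "u t"])
       (use that fu U V in \<open>auto simp: mono_dominated_def\<close>)
  obtain s where s: "s \<in> T" "max_exp T (\<lambda>t. g t + f t) = exp (g s + f s)"
    by (rule max_exp_obtains[OF T])
  obtain t where t: "t \<in> T" "max_exp T (\<lambda>t. g t - f t) = exp (g t - f t)"
    by (rule max_exp_obtains[OF T])
  show ?thesis using *[OF s(1) t(1)] unfolding s(2) t(2) by (simp flip: exp_add)
qed

text \<open>The exponent is the midpoint of g + 2 f and g - 2 m. Used with m the mean of f,
  convexity thus separates the random part from its centring, at the price of doubling both.\<close>

lemma max_exp_symmetrization:
  fixes f g m :: "'t \<Rightarrow> real"
  assumes T: "finite T" "T \<noteq> {}"
  shows "max_exp T (\<lambda>t. g t + (f t - m t))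
     \<le> (max_exp T (\<lambda>t. g t + 2 * f t) + max_exp T (\<lambda>t. g t - 2 * m t)) / 2"
proof (rule max_exp_leI[OF T])
  fix t assume "t \<in> T"
  have "exp ((1 - 1/2) *\<^sub>R (g t + 2 * f t) + (1/2) *\<^sub>R (g t - 2 * m t))
    \<le> (1 - 1/2) * exp (g t + 2 * f t) + (1/2) * exp (g t - 2 * m t)"
    by (rule convex_onD[OF exp_convex]) auto
  moreover have "(1 - 1/2) *\<^sub>R (g t + 2 * f t) + (1/2) *\<^sub>R (g t - 2 * m t) = g t + (f t - m t)"
    by (simp add: field_simps)
  ultimately show "exp (g t + (f t - m t))
     \<le> (max_exp T (\<lambda>t. g t + 2 * f t) + max_exp T (\<lambda>t. g t - 2 * m t)) / 2"
    using exp_le_max_exp[OF T(1) \<open>t \<in> T\<close>, of "\<lambda>t. g t + 2 * f t"]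
      exp_le_max_exp[OF T(1) \<open>t \<in> T\<close>, of "\<lambda>t. g t - 2 * m t"] by simp
qed

lemma mono_dominated_scale:
  assumes "mono_dominated T f u" "0 < (c::real)"
  shows "mono_dominated T (\<lambda>t. c * f t) (\<lambda>t. c * u t)"
  using assms by (simp add: mono_dominated_def zero_le_mult_iff mult_le_0_iff flip: right_diff_distrib)

lemma ennreal_half_add:
  assumes "0 \<le> p" "0 \<le> q"
  shows "ennreal (1/2) * (ennreal p + ennreal q) = ennreal ((p + q) / 2)"
proof -
  have "ennreal (1/2) * (ennreal p + ennreal q) = ennreal (1/2 * (p + q))"
    using assms by (subst ennreal_plus[symmetric], simp, simp, subst ennreal_mult[symmetric]) auto
  then show ?thesis by simp
qed

section \<open>Exponential moments for one observation and for a product sample\<close>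

context prob_space
begin

lemma integrable_bounded:
  fixes f :: "'a \<Rightarrow> real"
  assumes "f \<in> borel_measurable M" "\<And>x. x \<in> space M \<Longrightarrow> \<bar>f x\<bar> \<le> c"
  shows "integrable M f"
  using assms by (intro integrable_const_bound[where B = c]) auto

text \<open>The maximizer on the left does not depend on the observation, so Jensen's inequality at
  this single index suffices.\<close>

lemma max_exp_expectation_le:
  fixes f :: "'t \<Rightarrow> 'a \<Rightarrow> real"
  assumes T: "finite T" "T \<noteq> {}"
    and meas: "\<And>t. t \<in> T \<Longrightarrow> f t \<in> borel_measurable M"
    and bnd: "\<And>t x. t \<in> T \<Longrightarrow> x \<in> space M \<Longrightarrow> \<bar>f t x\<bar> \<le> c"
  shows "ennreal (max_exp T (\<lambda>t. g t - 2 * expectation (f t)))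
    \<le> (\<integral>\<^sup>+x. ennreal (max_exp T (\<lambda>t. g t - 2 * f t x)) \<partial>M)"
proof -
  obtain t where t: "t \<in> T" "max_exp T (\<lambda>t. g t - 2 * expectation (f t)) = exp (g t - 2 * expectation (f t))"
    by (rule max_exp_obtains[OF T])
  note [measurable] = meas[OF t(1)]
  have int: "integrable M (f t)" using meas bnd t by (intro integrable_bounded[of _ c]) auto
  have int_exp: "integrable M (\<lambda>x. exp (g t - 2 * f t x))"
    by (rule integrable_bounded[of _ "exp (g t + 2 * c)"]) (use bnd[OF t(1)] in \<open>auto simp: abs_le_iff\<close>)
  have "exp (expectation (\<lambda>x. g t - 2 * f t x)) \<le> expectation (\<lambda>x. exp (g t - 2 * f t x))"
    by (rule jensens_inequality[of _ UNIV]) (use int int_exp in \<open>auto intro: exp_convex\<close>)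
  then have "ennreal (exp (g t - 2 * expectation (f t))) \<le> ennreal (expectation (\<lambda>x. exp (g t - 2 * f t x)))"
    using int by (simp add: prob_space)
  also have "\<dots> = (\<integral>\<^sup>+x. ennreal (exp (g t - 2 * f t x)) \<partial>M)"
    using int_exp by (intro nn_integral_eq_integral[symmetric]) auto
  also have "\<dots> \<le> (\<integral>\<^sup>+x. ennreal (max_exp T (\<lambda>t. g t - 2 * f t x)) \<partial>M)"
    using exp_le_max_exp[OF T(1) t(1), of "\<lambda>t. g t - 2 * f t x" for x]
    by (intro nn_integral_mono ennreal_leI)
  finally show ?thesis using t(2) by simp
qed

text \<open>Symmetrization needs no ghost sample here: the centring term is removed by convexity of
  the exponential and Jensen's inequality, one observation at a time.\<close>

lemma nn_integral_max_exp_step: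
  fixes f u :: "'t \<Rightarrow> 'a \<Rightarrow> real"
  assumes T: "finite T" "T \<noteq> {}"
    and meas [measurable]: "\<And>t. t \<in> T \<Longrightarrow> f t \<in> borel_measurable M"
    and bnd: "\<And>t x. t \<in> T \<Longrightarrow> x \<in> space M \<Longrightarrow> \<bar>f t x\<bar> \<le> c"
    and dom: "\<And>x. x \<in> space M \<Longrightarrow> mono_dominated T (\<lambda>t. f t x) (\<lambda>t. u t x)"
  shows "(\<integral>\<^sup>+x. ennreal (max_exp T (\<lambda>t. g t + (f t x - expectation (f t)))) \<partial>M)
    \<le> (\<integral>\<^sup>+x. ennreal (1/2) * (ennreal (max_exp T (\<lambda>t. g t + 2 * u t x))
                            + ennreal (max_exp T (\<lambda>t. g t - 2 * u t x))) \<partial>M)"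
proof -
  note nn = max_exp_nonneg[OF T]
  have [measurable]: "(\<lambda>x. max_exp T (\<lambda>t. g t + 2 * f t x)) \<in> borel_measurable M"
    "(\<lambda>x. max_exp T (\<lambda>t. g t - 2 * f t x)) \<in> borel_measurable M"
    using T(1) by measurable
  let ?U = "\<lambda>x. ennreal (max_exp T (\<lambda>t. g t + 2 * f t x))"
  have "(\<integral>\<^sup>+x. ennreal (max_exp T (\<lambda>t. g t + (f t x - expectation (f t)))) \<partial>M)
    \<le> (\<integral>\<^sup>+x. ennreal (1/2) * (?U x + ennreal (max_exp T (\<lambda>t. g t - 2 * expectation (f t)))) \<partial>M)"
    unfolding ennreal_half_add[OF nn nn]
    by (intro nn_integral_mono ennreal_leI max_exp_symmetrization T)
  also have "\<dots> = ennreal (1/2) * ((\<integral>\<^sup>+x. ?U x \<partial>M) + ennreal (max_exp T (\<lambda>t. g t - 2 * expectation (f t))))"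
    by (subst nn_integral_cmult, simp, subst nn_integral_add) (simp_all add: emeasure_space_1)
  also have "\<dots> \<le> ennreal (1/2) * ((\<integral>\<^sup>+x. ?U x \<partial>M) + (\<integral>\<^sup>+x. ennreal (max_exp T (\<lambda>t. g t - 2 * f t x)) \<partial>M))"
    by (intro mult_left_mono add_left_mono max_exp_expectation_le[OF T meas bnd]) auto
  \<comment> \<open>Both integrals are over the same law, so they merge into one whose integrand
    carries both signs at a single x. Contraction then applies pointwise in x.\<close>
  also have "\<dots> = (\<integral>\<^sup>+x. ennreal (1/2) * (?U x + ennreal (max_exp T (\<lambda>t. g t - 2 * f t x))) \<partial>M)"
    by (subst nn_integral_cmult, simp, subst nn_integral_add) simp_all
  also have "\<dots> \<le> (\<integral>\<^sup>+x. ennreal (1/2) * (ennreal (max_exp T (\<lambda>t. g t + 2 * u t x))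
                            + ennreal (max_exp T (\<lambda>t. g t - 2 * u t x))) \<partial>M)"
  proof (rule nn_integral_mono)
    fix x assume "x \<in> space M"
    then have "mono_dominated T (\<lambda>t. 2 * f t x) (\<lambda>t. 2 * u t x)"
      by (intro mono_dominated_scale dom) auto
    from max_exp_contraction[OF T this, of g]
    show "ennreal (1/2) * (?U x + ennreal (max_exp T (\<lambda>t. g t - 2 * f t x)))
      \<le> ennreal (1/2) * (ennreal (max_exp T (\<lambda>t. g t + 2 * u t x)) + ennreal (max_exp T (\<lambda>t. g t - 2 * u t x)))"
      unfolding ennreal_half_add[OF nn nn] by (intro ennreal_leI) simp
  qed
  finally show ?thesis .
qed

text \<open>The bound is stated for every offset \<open>g\<close> dominated by a convex combination of the \<open>a j\<close>:
  this class of offsets is stable under adding \<open>\<plusminus> 2 u\<close>, which closes the induction, and the passage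
  from the convex hull to its \<open>card J\<close> generators is made at the very end.\<close>

lemma nn_integral_max_exp_PiM:
  fixes f :: "'t \<Rightarrow> 'a \<Rightarrow> real" and b :: "'j \<Rightarrow> 'a \<Rightarrow> real" and w :: "'t \<Rightarrow> 'j \<Rightarrow> real" and I :: "'i set"
  assumes T: "finite T" "T \<noteq> {}" and J: "finite J"
    and w: "\<And>t j. t \<in> T \<Longrightarrow> j \<in> J \<Longrightarrow> 0 \<le> w t j" "\<And>t. t \<in> T \<Longrightarrow> (\<Sum>j\<in>J. w t j) = 1"
    and meas [measurable]: "\<And>t. t \<in> T \<Longrightarrow> f t \<in> borel_measurable M"
    and measb [measurable]: "\<And>j. j \<in> J \<Longrightarrow> b j \<in> borel_measurable M"
    and bnd: "\<And>t x. t \<in> T \<Longrightarrow> x \<in> space M \<Longrightarrow> \<bar>f t x\<bar> \<le> d"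
    and bb: "\<And>j x. j \<in> J \<Longrightarrow> x \<in> space M \<Longrightarrow> \<bar>b j x\<bar> \<le> 1"
    and dom: "\<And>x. x \<in> space M \<Longrightarrow> mono_dominated T (\<lambda>t. f t x) (\<lambda>t. c * (\<Sum>j\<in>J. w t j * b j x))"
    and "finite I"
    and g: "\<And>t. t \<in> T \<Longrightarrow> g t \<le> (\<Sum>j\<in>J. w t j * a j)"
  shows "(\<integral>\<^sup>+x. ennreal (max_exp T (\<lambda>t. g t + (\<Sum>i\<in>I. f t (x i) - expectation (f t)))) \<partial>PiM I (\<lambda>_. M))
    \<le> ennreal ((\<Sum>j\<in>J. exp (a j)) * exp (2 * c\<^sup>2) ^ card I)"
  using \<open>finite I\<close> g
proof (induction I arbitrary: g a rule: finite_induct)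
  case empty
  have "max_exp T g \<le> (\<Sum>j\<in>J. exp (a j))"
  proof (rule max_exp_leI[OF T])
    fix t assume t: "t \<in> T"
    have "J \<noteq> {}" using w(2)[OF t] by auto
    \<comment> \<open>A convex combination of the \<open>a j\<close> is at most the largest of them,
      whose exponential is one term of the sum.\<close>
    then have "Max (a ` J) \<in> a ` J" using J by (intro Max_in) auto
    then obtain j where j: "j \<in> J" "Max (a ` J) = a j" by auto
    have "g t \<le> (\<Sum>j\<in>J. w t j * a j)" using empty t by simp
    also have "\<dots> \<le> (\<Sum>k\<in>J. w t k * a j)"
      using J t w(1) unfolding j(2)[symmetric] by (intro sum_mono mult_left_mono) auto
    also have "\<dots> = a j" by (simp add: w(2)[OF t] flip: sum_distrib_right)
    finally have "exp (g t) \<le> exp (a j)" by simp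
    also have "\<dots> \<le> (\<Sum>j\<in>J. exp (a j))" using J j by (intro member_le_sum) auto
    finally show "exp (g t) \<le> (\<Sum>j\<in>J. exp (a j))" .
  qed
  then show ?case
    using prob_space.emeasure_space_1[OF prob_space_PiM[of "{}::'i set" "\<lambda>_. M"]]
    by (simp add: ennreal_leI)
next
  case (insert i I)
  interpret product_sigma_finite "\<lambda>_::'i. M" by standard
  interpret I: prob_space "PiM I (\<lambda>_::'i. M)" by (intro prob_space_PiM prob_space_axioms)
  interpret pair_sigma_finite "PiM I (\<lambda>_::'i. M)" M by standard
  define S where "S t x = (\<Sum>i\<in>I. f t (x i) - expectation (f t))" for t and x :: "'i \<Rightarrow> 'a"
  define u where "u t y = c * (\<Sum>j\<in>J. w t j * b j y)" for t y
  have [measurable]: "(\<lambda>x. S t x) \<in> borel_measurable (PiM I (\<lambda>_. M))" if "t \<in> T" for t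
    unfolding S_def using that by measurable
  have [measurable]: "u t \<in> borel_measurable M" for t
    unfolding u_def by measurable
  let ?C = "exp (2 * c\<^sup>2)"
  have meas_ins: "(\<lambda>x. ennreal (max_exp T (\<lambda>t. g t + (\<Sum>i\<in>insert i I. f t (x i) - expectation (f t)))))
     \<in> borel_measurable (PiM (insert i I) (\<lambda>_. M))"
    using T(1) by measurable
  have meas_pair: "(\<lambda>(x, y). ennreal (1/2) * (ennreal (max_exp T (\<lambda>t. g t + S t x + 2 * u t y))
       + ennreal (max_exp T (\<lambda>t. g t + S t x - 2 * u t y)))) \<in> borel_measurable (PiM I (\<lambda>_. M) \<Otimes>\<^sub>M M)"
    using T(1) by measurable
  have "(\<integral>\<^sup>+x. ennreal (max_exp T (\<lambda>t. g t + (\<Sum>i\<in>insert i I. f t (x i) - expectation (f t))))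
        \<partial>PiM (insert i I) (\<lambda>_. M))
    = (\<integral>\<^sup>+x. \<integral>\<^sup>+y. ennreal (max_exp T (\<lambda>t. g t + S t x + (f t y - expectation (f t)))) \<partial>M \<partial>PiM I (\<lambda>_. M))"
  proof (subst product_nn_integral_insert[OF insert.hyps(1,2) meas_ins], intro nn_integral_cong)
    fix x y
    have "(\<Sum>k\<in>insert i I. f t ((x(i := y)) k) - expectation (f t)) = S t x + (f t y - expectation (f t))" for t
    proof -
      have "(\<Sum>k\<in>I. f t ((x(i := y)) k) - expectation (f t)) = S t x"
        unfolding S_def using insert.hyps(2) by (intro sum.cong) auto
      then show ?thesis using insert.hyps by (simp add: add.commute)
    qed
    then show "ennreal (max_exp T (\<lambda>t. g t + (\<Sum>k\<in>insert i I. f t ((x(i := y)) k) - expectation (f t))))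
      = ennreal (max_exp T (\<lambda>t. g t + S t x + (f t y - expectation (f t))))" by (simp add: add.assoc)
  qed
  also have "\<dots> \<le> (\<integral>\<^sup>+x. \<integral>\<^sup>+y. ennreal (1/2) * (ennreal (max_exp T (\<lambda>t. g t + S t x + 2 * u t y))
       + ennreal (max_exp T (\<lambda>t. g t + S t x - 2 * u t y))) \<partial>M \<partial>PiM I (\<lambda>_. M))"
    using dom unfolding u_def[symmetric]
    by (intro nn_integral_mono nn_integral_max_exp_step[OF T meas bnd])
  \<comment> \<open>Integrating over the new observation y last lets the induction hypothesis run at
    fixed y, where \<open>u t y\<close> becomes part of the offset.\<close>
  also have "\<dots> = (\<integral>\<^sup>+y. \<integral>\<^sup>+x. ennreal (1/2) * (ennreal (max_exp T (\<lambda>t. g t + S t x + 2 * u t y))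
       + ennreal (max_exp T (\<lambda>t. g t + S t x - 2 * u t y))) \<partial>PiM I (\<lambda>_. M) \<partial>M)"
    by (rule Fubini'[OF meas_pair, symmetric])
  also have "\<dots> \<le> (\<integral>\<^sup>+y. ennreal ((\<Sum>j\<in>J. exp (a j)) * ?C ^ card (insert i I)) \<partial>M)"
  proof (rule nn_integral_mono)
    fix y assume y: "y \<in> space M"
    \<comment> \<open>Needed for z = 2 and z = - 2; the values \<open>a j\<close> are shifted along
      with the offset.\<close>
    have IH: "(\<integral>\<^sup>+x. ennreal (max_exp T (\<lambda>t. g t + S t x + z * u t y)) \<partial>PiM I (\<lambda>_. M))
      \<le> ennreal ((\<Sum>j\<in>J. exp (a j + z * c * b j y)) * ?C ^ card I)" for z
    proof -
      have "g t + z * u t y \<le> (\<Sum>j\<in>J. w t j * (a j + z * c * b j y))" if "t \<in> T" for t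
        using insert.prems[OF that] by (simp add: u_def distrib_left sum.distrib sum_distrib_left ac_simps)
      from insert.IH[OF this] show ?thesis by (simp add: S_def[symmetric] ac_simps)
    qed
    \<comment> \<open>The sign is averaged separately at each generator: cosh (2 c b) is at most exp
      (2 c^2) because b lies in [-1, 1].\<close>
    have *: "exp (a j + 2 * c * b j y) + exp (a j + - 2 * c * b j y) \<le> 2 * (exp (a j) * ?C)" if "j \<in> J" for j
    proof -
      have "(exp (2 * c * b j y) + exp (- (2 * c * b j y))) / 2 \<le> exp ((2 * c * b j y)\<^sup>2 / 2)"
        by (rule cosh_le_exp_sq)
      also have "\<dots> \<le> ?C"
        using bb[OF that y] by (simp add: power_mult_distrib abs_square_le_1 mult_left_le)
      finally have "exp (a j) * (exp (2 * c * b j y) + exp (- (2 * c * b j y))) \<le> exp (a j) * (2 * ?C)"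
        by (intro mult_left_mono) auto
      then show ?thesis by (simp add: exp_add exp_diff exp_minus divide_inverse distrib_left)
    qed
    have "(\<integral>\<^sup>+x. ennreal (1/2) * (ennreal (max_exp T (\<lambda>t. g t + S t x + 2 * u t y))
       + ennreal (max_exp T (\<lambda>t. g t + S t x - 2 * u t y))) \<partial>PiM I (\<lambda>_. M))
      = ennreal (1/2) * ((\<integral>\<^sup>+x. ennreal (max_exp T (\<lambda>t. g t + S t x + 2 * u t y)) \<partial>PiM I (\<lambda>_. M))
       + (\<integral>\<^sup>+x. ennreal (max_exp T (\<lambda>t. g t + S t x + - 2 * u t y)) \<partial>PiM I (\<lambda>_. M)))"
      using T(1) by (subst nn_integral_cmult, measurable, subst nn_integral_add, measurable)
    also have "\<dots> \<le> ennreal (1/2) * (ennreal ((\<Sum>j\<in>J. exp (a j + 2 * c * b j y)) * ?C ^ card I)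
       + ennreal ((\<Sum>j\<in>J. exp (a j + - 2 * c * b j y)) * ?C ^ card I))"
      by (intro mult_left_mono add_mono IH) auto
    also have "\<dots> = ennreal ((\<Sum>j\<in>J. exp (a j + 2 * c * b j y) + exp (a j + - 2 * c * b j y)) / 2 * ?C ^ card I)"
      by (subst ennreal_half_add) (simp_all add: sum_nonneg sum.distrib distrib_right add_divide_distrib)
    also have "\<dots> \<le> ennreal ((\<Sum>j\<in>J. 2 * (exp (a j) * ?C)) / 2 * ?C ^ card I)"
      by (intro ennreal_leI mult_right_mono divide_right_mono sum_mono *) auto
    also have "\<dots> = ennreal ((\<Sum>j\<in>J. exp (a j)) * ?C ^ card (insert i I))"
      using insert.hyps by (simp add: ac_simps flip: sum_distrib_left sum_distrib_right)
    finally show "(\<integral>\<^sup>+x. ennreal (1/2) * (ennreal (max_exp T (\<lambda>t. g t + S t x + 2 * u t y))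
       + ennreal (max_exp T (\<lambda>t. g t + S t x - 2 * u t y))) \<partial>PiM I (\<lambda>_. M))
      \<le> ennreal ((\<Sum>j\<in>J. exp (a j)) * ?C ^ card (insert i I))" .
  qed
  also have "\<dots> = ennreal ((\<Sum>j\<in>J. exp (a j)) * ?C ^ card (insert i I))"
    by (simp add: emeasure_space_1)
  finally show ?case .
qed

end

section \<open>Deviation of the empirical means\<close>

lemma iid_sample_distr_PiM:
  assumes "prob_space W" "iid_sample W P n Z" "1 \<le> n"
  shows "distr W (PiM {1..n} (\<lambda>_. P)) (\<lambda>\<omega>. \<lambda>i\<in>{1..n}. Z i \<omega>) = PiM {1..n} (\<lambda>_. P)"
    and "i \<in> {1..n} \<Longrightarrow> Z i \<in> W \<rightarrow>\<^sub>M P"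
    and "prob_space P"
proof -
  interpret prob_space W by fact
  have ind: "indep_vars (\<lambda>_. P) Z {1..n}" and d: "\<And>i. i \<in> {1..n} \<Longrightarrow> distr W P (Z i) = P"
    using assms(2) by (auto simp: iid_sample_def)
  have rv: "Z i \<in> W \<rightarrow>\<^sub>M P" if "i \<in> {1..n}" for i
    using ind that by (simp add: indep_vars_def)
  then show "i \<in> {1..n} \<Longrightarrow> Z i \<in> W \<rightarrow>\<^sub>M P" .
  have "distr W (PiM {1..n} (\<lambda>_. P)) (\<lambda>\<omega>. \<lambda>i\<in>{1..n}. Z i \<omega>) = PiM {1..n} (\<lambda>i. distr W P (Z i))"
    using ind rv assms(3) by (subst indep_vars_iff_distr_eq_PiM'[symmetric]) auto
  also have "\<dots> = PiM {1..n} (\<lambda>_. P)"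
    using d by (intro PiM_cong) auto
  finally show "distr W (PiM {1..n} (\<lambda>_. P)) (\<lambda>\<omega>. \<lambda>i\<in>{1..n}. Z i \<omega>) = PiM {1..n} (\<lambda>_. P)" .
  \<comment> \<open>\<open>P\<close> has total mass 1 as the law of an observation;
    \<open>1 \<le> n\<close> supplies the index.\<close>
  have "prob_space (distr W P (Z 1))" using rv[of 1] assms(3) by (intro prob_space_distr) auto
  then show "prob_space P" using d[of 1] assms(3) by simp
qed

lemma convex_combination_abs_le_1:
  fixes w b :: "'j \<Rightarrow> real"
  assumes "\<And>j. j \<in> J \<Longrightarrow> 0 \<le> w j" "(\<Sum>j\<in>J. w j) = 1" "\<And>j. j \<in> J \<Longrightarrow> \<bar>b j\<bar> \<le> 1"
  shows "\<bar>\<Sum>j\<in>J. w j * b j\<bar> \<le> 1"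
proof -
  have "\<bar>\<Sum>j\<in>J. w j * b j\<bar> \<le> (\<Sum>j\<in>J. w j * 1)"
    using assms by (intro order.trans[OF sum_abs] sum_mono) (auto simp: abs_mult intro!: mult_left_le)
  then show ?thesis using assms by simp
qed

text \<open>Chernoff's method for the largest deviation over \<open>T\<close>. The map \<psi> will
  be the surrogate shifted to vanish at 0, or its reflection for the lower tail.\<close>

lemma measure_sup_deviation_le:
  fixes b :: "'j \<Rightarrow> 'a \<Rightarrow> real" and w :: "'t \<Rightarrow> 'j \<Rightarrow> real" and \<psi> :: "real \<Rightarrow> real"
  assumes W: "prob_space W" and iid: "iid_sample W P n Z" and n: "1 \<le> n"
    and T: "finite T" "T \<noteq> {}" and J: "finite J"
    and w: "\<And>t j. t \<in> T \<Longrightarrow> j \<in> J \<Longrightarrow> 0 \<le> w t j" "\<And>t. t \<in> T \<Longrightarrow> (\<Sum>j\<in>J. w t j) = 1"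
    and measb: "\<And>j. j \<in> J \<Longrightarrow> b j \<in> borel_measurable P"
    and bb: "\<And>j x. j \<in> J \<Longrightarrow> x \<in> space P \<Longrightarrow> \<bar>b j x\<bar> \<le> 1"
    and F: "\<And>t x. F t x = \<psi> (\<Sum>j\<in>J. w t j * b j x)"
    and measF: "\<And>t. t \<in> T \<Longrightarrow> F t \<in> borel_measurable P"
    and \<psi>0: "\<psi> 0 = 0"
    and \<psi>: "\<And>x y. -1 \<le> x \<Longrightarrow> x \<le> y \<Longrightarrow> y \<le> 1 \<Longrightarrow> 0 \<le> \<psi> y - \<psi> x \<and> \<psi> y - \<psi> x \<le> L * (y - x)"
    and L: "0 < L" and \<tau>: "0 < \<tau>"
  shows "measure W {\<omega> \<in> space W. \<exists>t\<in>T. \<tau> \<le> (1 / real n) * (\<Sum>i=1..n. F t (Z i \<omega>)) - (\<integral>x. F t x \<partial>P)}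
    \<le> real (card J) * exp (- (\<tau>\<^sup>2 * real n / (8 * L\<^sup>2)))"
proof -
  interpret W: prob_space W by fact
  interpret P: prob_space P using iid_sample_distr_PiM(3)[OF W iid n] .
  have Z [measurable]: "Z i \<in> W \<rightarrow>\<^sub>M P" if "i \<in> {1..n}" for i
    using iid_sample_distr_PiM(2)[OF W iid n that] .
  note [measurable] = measb measF
  \<comment> \<open>This s minimizes 2 s^2 L^2 - s tau, the exponent per observation.\<close>
  define s where "s = \<tau> / (4 * L\<^sup>2)"
  have s: "0 < s" using \<tau> L by (simp add: s_def)
  define f where "f t x = s * F t x" for t x
  have measf [measurable]: "f t \<in> borel_measurable P" if "t \<in> T" for t
    unfolding f_def using that by measurable
  have u: "\<bar>\<Sum>j\<in>J. w t j * b j x\<bar> \<le> 1" if "t \<in> T" "x \<in> space P" for t x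
    using that w bb by (intro convex_combination_abs_le_1) auto
  have dom: "mono_dominated T (\<lambda>t. f t x) (\<lambda>t. (s * L) * (\<Sum>j\<in>J. w t j * b j x))" if x: "x \<in> space P" for x
  proof -
    have "mono_dominated T (\<lambda>t. F t x) (\<lambda>t. L * (\<Sum>j\<in>J. w t j * b j x))"
      unfolding mono_dominated_def F
    proof (intro conjI ballI impI)
      fix t assume t: "t \<in> T"
      let ?u = "\<Sum>j\<in>J. w t j * b j x"
      show "0 \<le> \<psi> ?u \<and> \<psi> ?u \<le> L * ?u \<or> L * ?u \<le> \<psi> ?u \<and> \<psi> ?u \<le> 0"
        using \<psi>[of 0 ?u] \<psi>[of ?u 0] u[OF t x] \<psi>0 by (cases "0 \<le> ?u") (auto simp: abs_le_iff)
    next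
      fix t r assume t: "t \<in> T" "r \<in> T" "L * (\<Sum>j\<in>J. w t j * b j x) \<le> L * (\<Sum>j\<in>J. w r j * b j x)"
      then show "0 \<le> \<psi> (\<Sum>j\<in>J. w r j * b j x) - \<psi> (\<Sum>j\<in>J. w t j * b j x)"
        "\<psi> (\<Sum>j\<in>J. w r j * b j x) - \<psi> (\<Sum>j\<in>J. w t j * b j x)
          \<le> L * (\<Sum>j\<in>J. w r j * b j x) - L * (\<Sum>j\<in>J. w t j * b j x)"
        using \<psi>[of "\<Sum>j\<in>J. w t j * b j x" "\<Sum>j\<in>J. w r j * b j x"] u[OF t(1) x] u[OF t(2) x] L
        by (auto simp: abs_le_iff right_diff_distrib)
    qed
    from mono_dominated_scale[OF this s] show ?thesis by (simp add: f_def ac_simps)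
  qed
  have fbnd: "\<bar>f t x\<bar> \<le> s * L" if "t \<in> T" "x \<in> space P" for t x
  proof -
    have "\<bar>f t x\<bar> \<le> \<bar>s * L * (\<Sum>j\<in>J. w t j * b j x)\<bar>"
      using dom[OF that(2)] that(1) unfolding mono_dominated_def by fastforce
    also have "\<dots> \<le> s * L"
      using u[OF that] s L by (simp add: abs_mult mult_left_le)
    finally show ?thesis .
  qed
  have Ef: "P.expectation (f t) = s * P.expectation (F t)" for t
    by (simp add: f_def[abs_def])
  define D where "D x = max_exp T (\<lambda>t. \<Sum>i=1..n. f t (x i) - P.expectation (f t))" for x
  have [measurable]: "D \<in> borel_measurable (PiM {1..n} (\<lambda>_. P))"
    unfolding D_def using T(1) by measurable
  have ZZ [measurable]: "(\<lambda>\<omega>. \<lambda>i\<in>{1..n}. Z i \<omega>) \<in> W \<rightarrow>\<^sub>M PiM {1..n} (\<lambda>_. P)"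
    by measurable
  have [measurable]: "(\<lambda>\<omega>. D (\<lambda>i\<in>{1..n}. Z i \<omega>)) \<in> borel_measurable W"
    by (rule measurable_compose[OF ZZ]) measurable
  let ?DZ = "\<lambda>\<omega>. ennreal (D (\<lambda>i\<in>{1..n}. Z i \<omega>))"
  let ?k = "exp (- (s * (real n * \<tau>)))"
  have mgf: "(\<integral>\<^sup>+\<omega>. ?DZ \<omega> \<partial>W) \<le> ennreal (real (card J) * exp (2 * (s * L)\<^sup>2) ^ n)"
  proof -
    have "(\<integral>\<^sup>+\<omega>. ?DZ \<omega> \<partial>W) = (\<integral>\<^sup>+x. ennreal (D x) \<partial>distr W (PiM {1..n} (\<lambda>_. P)) (\<lambda>\<omega>. \<lambda>i\<in>{1..n}. Z i \<omega>))"
      by (subst nn_integral_distr[OF ZZ]) measurable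
    also have "\<dots> = (\<integral>\<^sup>+x. ennreal (D x) \<partial>PiM {1..n} (\<lambda>_. P))"
      by (simp only: iid_sample_distr_PiM(1)[OF W iid n])
    \<comment> \<open>Starting from offset 0 and all \<open>a j\<close> equal to 0, the sum of
      exponentials is just \<open>card J\<close>.\<close>
    also have "\<dots> \<le> ennreal ((\<Sum>j\<in>J. exp 0) * exp (2 * (s * L)\<^sup>2) ^ card {1..n})"
      unfolding D_def
      using P.nn_integral_max_exp_PiM[OF T J w measf measb fbnd bb dom, of "{1..n}" "\<lambda>_. 0" "\<lambda>_. 0"] by simp
    finally show ?thesis by simp
  qed
  have "emeasure W {\<omega> \<in> space W. \<exists>t\<in>T. \<tau> \<le> (1 / real n) * (\<Sum>i=1..n. F t (Z i \<omega>)) - (\<integral>x. F t x \<partial>P)}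
    \<le> emeasure W {\<omega> \<in> space W. 1 \<le> ennreal ?k * ?DZ \<omega>}"
  proof (intro emeasure_mono subsetI)
    fix \<omega> assume "\<omega> \<in> {\<omega> \<in> space W. \<exists>t\<in>T. \<tau> \<le> (1 / real n) * (\<Sum>i=1..n. F t (Z i \<omega>)) - (\<integral>x. F t x \<partial>P)}"
    then obtain t where t: "t \<in> T" "\<omega> \<in> space W"
      "\<tau> \<le> (1 / real n) * (\<Sum>i=1..n. F t (Z i \<omega>)) - (\<integral>x. F t x \<partial>P)" by auto
    have "real n * \<tau> \<le> real n * ((1 / real n) * (\<Sum>i=1..n. F t (Z i \<omega>)) - (\<integral>x. F t x \<partial>P))"
      using t(3) by (intro mult_left_mono) auto
    also have "\<dots> = (\<Sum>i=1..n. F t (Z i \<omega>) - (\<integral>x. F t x \<partial>P))"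
      using n by (simp add: sum_subtractf right_diff_distrib)
    finally have "real n * \<tau> \<le> (\<Sum>i=1..n. F t (Z i \<omega>) - (\<integral>x. F t x \<partial>P))" .
    then have "s * (real n * \<tau>) \<le> (\<Sum>i=1..n. f t (Z i \<omega>) - P.expectation (f t))"
      using s \<open>t \<in> T\<close> by (simp add: Ef f_def flip: right_diff_distrib sum_distrib_left)
    also have "\<dots> = (\<Sum>i=1..n. f t ((\<lambda>i\<in>{1..n}. Z i \<omega>) i) - P.expectation (f t))"
      by (intro sum.cong) auto
    finally have "exp (s * (real n * \<tau>)) \<le> D (\<lambda>i\<in>{1..n}. Z i \<omega>)"
      using exp_le_max_exp[OF T(1) t(1), of "\<lambda>t. \<Sum>i=1..n. f t ((\<lambda>i\<in>{1..n}. Z i \<omega>) i) - P.expectation (f t)"]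
      unfolding D_def by (meson exp_le_cancel_iff order.trans)
    then have "1 \<le> ?k * D (\<lambda>i\<in>{1..n}. Z i \<omega>)"
      by (simp add: exp_minus field_simps)
    then show "\<omega> \<in> {\<omega> \<in> space W. 1 \<le> ennreal ?k * ?DZ \<omega>}"
      using t(2) by (simp flip: ennreal_mult')
  qed measurable
  also have "\<dots> \<le> ennreal ?k * (\<integral>\<^sup>+\<omega>. ?DZ \<omega> * indicator (space W) \<omega> \<partial>W)"
    by (rule nn_integral_Markov_inequality) measurable
  also have "\<dots> \<le> ennreal ?k * ennreal (real (card J) * exp (2 * (s * L)\<^sup>2) ^ n)"
    by (intro mult_left_mono order.trans[OF _ mgf] nn_integral_mono) (auto simp: indicator_def)
  also have "\<dots> = ennreal (real (card J) * (?k * exp (real n * (2 * (s * L)\<^sup>2))))"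
    by (simp add: ac_simps flip: ennreal_mult exp_of_nat_mult)
  also have "?k * exp (real n * (2 * (s * L)\<^sup>2)) = exp (- (\<tau>\<^sup>2 * real n / (8 * L\<^sup>2)))"
    using L by (simp add: s_def power2_eq_square field_simps flip: exp_add)
  finally show ?thesis
    by (simp add: W.emeasure_eq_measure)
qed

section \<open>Uniform deviation over the convex hull\<close>

text \<open>The coordinates outside {1..M} are free in \<open>simplex_weights\<close>, which
  destroys compactness in the product topology. Setting them to 0 restores it and changes no convex
  combination.\<close>

definition simplex_supp :: "nat \<Rightarrow> (nat \<Rightarrow> real) set" where
  "simplex_supp M = {l \<in> simplex_weights M. \<forall>j. j \<notin> {1..M} \<longrightarrow> l j = 0}"

definition convex_comb :: "nat \<Rightarrow> (nat \<Rightarrow> 'a \<Rightarrow> real) \<Rightarrow> (nat \<Rightarrow> real) \<Rightarrow> 'a \<Rightarrow> real" where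
  "convex_comb M h l = (\<lambda>x. \<Sum>j=1..M. l j * h j x)"

lemma Hconv_eq: "Hconv M h = convex_comb M h ` simplex_supp M"
proof -
  have "convex_comb M h l \<in> convex_comb M h ` simplex_supp M" if "l \<in> simplex_weights M" for l
  proof (rule image_eqI)
    show "convex_comb M h l = convex_comb M h (\<lambda>j. if j \<in> {1..M} then l j else 0)"
      by (simp add: convex_comb_def)
    show "(\<lambda>j. if j \<in> {1..M} then l j else 0) \<in> simplex_supp M"
      using that by (simp add: simplex_supp_def simplex_weights_def)
  qed
  then show ?thesis
    by (auto simp: Hconv_def simplex_supp_def convex_comb_def[abs_def])
qed

text \<open>Tychonoff's theorem for the box, cut by a closed hyperplane. The entries stay below 1
  because the others are nonnegative and the total is 1.\<close>

lemma compact_simplex_supp: "compact (simplex_supp M)"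
proof -
  let ?S = "\<lambda>j. if j \<in> {1..M} then {0..1} else {0} :: real set"
  have "compactin (product_topology (\<lambda>_. euclidean) UNIV) (Pi\<^sub>E UNIV ?S)"
    by (subst compactin_PiE) (auto simp: compactin_euclidean_iff)
  then have "compact (Pi\<^sub>E UNIV ?S)"
    by (simp add: euclidean_product_topology compactin_euclidean_iff)
  moreover have "closed {l :: nat \<Rightarrow> real. (\<Sum>j=1..M. l j) = 1}"
    by (intro closed_Collect_eq continuous_intros continuous_on_product_coordinates)
  ultimately have "compact (Pi\<^sub>E UNIV ?S \<inter> {l. (\<Sum>j=1..M. l j) = 1})"
    by (rule compact_Int_closed)
  also have "Pi\<^sub>E UNIV ?S \<inter> {l. (\<Sum>j=1..M. l j) = 1} = simplex_supp M"
  proof -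
    have "l j \<le> 1" if "l \<in> simplex_weights M" "j \<in> {1..M}" for l j
      using that member_le_sum[of j "{1..M}" l] by (auto simp: simplex_weights_def)
    then show ?thesis
      by (auto simp: simplex_supp_def simplex_weights_def PiE_iff split: if_splits)
  qed
  finally show ?thesis .
qed

lemma simplex_supp_nonempty: "1 \<le> M \<Longrightarrow> simplex_supp M \<noteq> {}"
proof -
  assume "1 \<le> M"
  then have "(\<lambda>j. if j = 1 then 1 else 0) \<in> simplex_supp M"
    by (auto simp: simplex_supp_def simplex_weights_def)
  then show ?thesis by auto
qed

text \<open>The l1 distance involves finitely many coordinates, so its balls are open in the product
  topology and compactness yields the centres.\<close>

lemma simplex_supp_finite_net:
  assumes "0 < \<eta>"
  obtains T where "finite T" "T \<subseteq> simplex_supp M"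
    "\<And>l. l \<in> simplex_supp M \<Longrightarrow> \<exists>t\<in>T. (\<Sum>j=1..M. \<bar>l j - t j\<bar>) < \<eta>"
proof -
  define U where "U t = {l :: nat \<Rightarrow> real. (\<Sum>j=1..M. \<bar>l j - t j\<bar>) < \<eta>}" for t
  have "open (U t)" for t
    unfolding U_def by (intro open_Collect_less continuous_intros continuous_on_product_coordinates)
  moreover have "simplex_supp M \<subseteq> (\<Union>t\<in>simplex_supp M. U t)"
    using assms by (auto simp: U_def)
  ultimately obtain T where "T \<subseteq> simplex_supp M" "finite T" "simplex_supp M \<subseteq> (\<Union>t\<in>T. U t)"
    using compactE_image[OF compact_simplex_supp, of "simplex_supp M" U] by metis
  then show thesis using that by (force simp: U_def)
qed

text \<open>Continuity refers to the product topology. Convergence there is coordinatewise, which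
  forces the finite l1 sum to 0.\<close>

lemma continuous_on_l1_lipschitz:
  fixes F :: "(nat \<Rightarrow> real) \<Rightarrow> real"
  assumes "\<And>l k. l \<in> S \<Longrightarrow> k \<in> S \<Longrightarrow> \<bar>F l - F k\<bar> \<le> L * (\<Sum>j=1..M. \<bar>l j - k j\<bar>)"
  shows "continuous_on S F"
  unfolding continuous_on_def
proof
  fix k assume k: "k \<in> S"
  have coord: "((\<lambda>l. l j) \<longlongrightarrow> k j) (at k within S)" for j
  proof -
    have "continuous_on S (\<lambda>l. l j)"
      by (rule continuous_on_subset[OF continuous_on_product_coordinates subset_UNIV])
    then show ?thesis using k by (simp add: continuous_on_def)
  qed
  have "((\<lambda>l. L * (\<Sum>j=1..M. \<bar>l j - k j\<bar>)) \<longlongrightarrow> L * (\<Sum>j=1..M. \<bar>k j - k j\<bar>)) (at k within S)"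
    by (intro tendsto_intros coord)
  then have "((\<lambda>l. L * (\<Sum>j=1..M. \<bar>l j - k j\<bar>)) \<longlongrightarrow> 0) (at k within S)" by simp
  moreover have "\<forall>\<^sub>F l in at k within S. norm (F l - F k) \<le> L * (\<Sum>j=1..M. \<bar>l j - k j\<bar>)"
    unfolding eventually_at_filter using assms k by (intro always_eventually) simp
  ultimately have "((\<lambda>l. F l - F k) \<longlongrightarrow> 0) (at k within S)"
    by (rule Lim_null_comparison[rotated])
  then show "(F \<longlongrightarrow> F k) (at k within S)" by (simp add: LIM_zero_iff)
qed

section \<open>Lipschitz estimates and measurability for surrogate errors\<close>

lemma convex_comb_dist:
  assumes "\<And>j. j \<in> {1..M} \<Longrightarrow> \<bar>h j x\<bar> \<le> 1"
  shows "\<bar>convex_comb M h l x - convex_comb M h k x\<bar> \<le> (\<Sum>j=1..M. \<bar>l j - k j\<bar>)"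
proof -
  have "convex_comb M h l x - convex_comb M h k x = (\<Sum>j=1..M. (l j - k j) * h j x)"
    by (simp add: convex_comb_def sum_subtractf left_diff_distrib)
  also have "\<bar>\<dots>\<bar> \<le> (\<Sum>j=1..M. \<bar>l j - k j\<bar>)"
    using assms by (intro order.trans[OF sum_abs] sum_mono) (auto simp: abs_mult intro!: mult_left_le)
  finally show ?thesis .
qed

lemma convex_comb_range:
  assumes "\<And>j. j \<in> {1..M} \<Longrightarrow> \<bar>h j x\<bar> \<le> 1" "l \<in> simplex_supp M"
  shows "convex_comb M h l x \<in> {-1..1}"
  using convex_combination_abs_le_1[of "{1..M}" l "\<lambda>j. h j x"] assms
  by (auto simp: convex_comb_def simplex_supp_def simplex_weights_def abs_le_iff)

lemma surrogate_increment:
  assumes "convex_surrogate \<phi>" "L-lipschitz_on {-1..1} \<phi>" "-1 \<le> x" "x \<le> y" "y \<le> 1"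
  shows "0 \<le> \<phi> y - \<phi> x \<and> \<phi> y - \<phi> x \<le> L * (y - x)"
proof
  show "0 \<le> \<phi> y - \<phi> x"
    using assms by (auto simp: convex_surrogate_def mono_on_def)
  show "\<phi> y - \<phi> x \<le> L * (y - x)"
    using lipschitz_onD[OF assms(2), of y x] assms by (auto simp: dist_real_def)
qed

lemma surrogate_dist:
  assumes "L-lipschitz_on {-1..1} \<phi>" "x \<in> {-1..1}" "y \<in> {-1..1}"
  shows "\<bar>\<phi> x - \<phi> y\<bar> \<le> L * \<bar>x - y\<bar>"
  using lipschitz_onD[OF assms(1), of x y] assms by (auto simp: dist_real_def)

text \<open>\<phi> is arbitrary outside [-1, 1], so the composition passes through the Borel sets
  restricted to that interval.\<close>

lemma surrogate_measurable:
  assumes "convex_surrogate \<phi>" "g \<in> borel_measurable P" "\<And>x. x \<in> space P \<Longrightarrow> g x \<in> {-1..1}"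
  shows "(\<lambda>x. \<phi> (g x)) \<in> borel_measurable P"
proof -
  have "\<phi> \<in> borel_measurable (restrict_space borel {-1..1})"
    using assms(1) by (intro borel_measurable_continuous_on_restrict) (auto simp: convex_surrogate_def)
  moreover have "g \<in> P \<rightarrow>\<^sub>M restrict_space borel {-1..1}"
    using assms by (intro measurable_restrict_space2) auto
  ultimately show ?thesis by (rule measurable_compose[rotated])
qed

lemma surrogate_bounds:
  assumes "convex_surrogate \<phi>" "x \<in> {-1..1}"
  shows "0 \<le> \<phi> x" "\<phi> x \<le> \<phi> 1"
  using assms by (auto simp: convex_surrogate_def mono_on_def)

text \<open>One class at a time. The plus class enters with negated classifiers, which turns type II
  errors into type I errors, so each result here serves both samples.\<close>

locale bounded_classifiers = prob_space P for P :: "'a measure" +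
  fixes M :: nat and h :: "nat \<Rightarrow> 'a \<Rightarrow> real" and \<phi> :: "real \<Rightarrow> real" and L :: real
  assumes h_meas [measurable]: "\<And>j. j \<in> {1..M} \<Longrightarrow> h j \<in> borel_measurable P"
    and h_bound: "\<And>j x. j \<in> {1..M} \<Longrightarrow> x \<in> space P \<Longrightarrow> \<bar>h j x\<bar> \<le> 1"
    and surr: "convex_surrogate \<phi>" and lip: "L-lipschitz_on {-1..1} \<phi>" and L_pos: "0 < L"
begin

lemma comb_range: "l \<in> simplex_supp M \<Longrightarrow> x \<in> space P \<Longrightarrow> convex_comb M h l x \<in> {-1..1}"
  using h_bound by (intro convex_comb_range) auto

lemma comb_meas: "convex_comb M h l \<in> borel_measurable P"
  unfolding convex_comb_def by measurable

lemma surr_comb_meas: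
  "l \<in> simplex_supp M \<Longrightarrow> (\<lambda>x. \<phi> (convex_comb M h l x)) \<in> borel_measurable P"
  by (intro surrogate_measurable[OF surr] comb_meas comb_range)

lemma surr_comb_integrable:
  "l \<in> simplex_supp M \<Longrightarrow> integrable P (\<lambda>x. \<phi> (convex_comb M h l x))"
  using surrogate_bounds[OF surr comb_range]
  by (intro integrable_bounded[of _ "\<phi> 1"] surr_comb_meas) (auto simp: abs_le_iff intro: order.trans)

lemma surr_comb_dist:
  assumes "l \<in> simplex_supp M" "k \<in> simplex_supp M" "x \<in> space P"
  shows "\<bar>\<phi> (convex_comb M h l x) - \<phi> (convex_comb M h k x)\<bar> \<le> L * (\<Sum>j=1..M. \<bar>l j - k j\<bar>)"
proof -
  have "\<bar>\<phi> (convex_comb M h l x) - \<phi> (convex_comb M h k x)\<bar>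
      \<le> L * \<bar>convex_comb M h l x - convex_comb M h k x\<bar>"
    using assms by (intro surrogate_dist[OF lip] comb_range)
  also have "\<dots> \<le> L * (\<Sum>j=1..M. \<bar>l j - k j\<bar>)"
    using L_pos h_bound assms(3) by (intro mult_left_mono convex_comb_dist) auto
  finally show ?thesis .
qed

lemma phi_type1_dist:
  assumes "l \<in> simplex_supp M" "k \<in> simplex_supp M"
  shows "\<bar>phi_type1 \<phi> P (convex_comb M h l) - phi_type1 \<phi> P (convex_comb M h k)\<bar>
    \<le> L * (\<Sum>j=1..M. \<bar>l j - k j\<bar>)"
proof -
  let ?d = "\<lambda>x. \<phi> (convex_comb M h l x) - \<phi> (convex_comb M h k x)"
  have int: "integrable P ?d"
    using assms by (intro Bochner_Integration.integrable_diff surr_comb_integrable)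
  have "\<bar>expectation ?d\<bar> \<le> expectation (\<lambda>x. \<bar>?d x\<bar>)" by (rule integral_abs_bound)
  also have "\<dots> \<le> expectation (\<lambda>x. L * (\<Sum>j=1..M. \<bar>l j - k j\<bar>))"
    using int assms by (intro integral_mono surr_comb_dist integrable_abs) auto
  also have "\<dots> = L * (\<Sum>j=1..M. \<bar>l j - k j\<bar>)"
    by (simp add: prob_space)
  finally show ?thesis
    using assms by (simp add: phi_type1_def surr_comb_integrable)
qed

lemma emp_phi_type1_dist:
  assumes "l \<in> simplex_supp M" "k \<in> simplex_supp M" "1 \<le> n" "\<And>i. i \<in> {1..n} \<Longrightarrow> z i \<in> space P"
  shows "\<bar>emp_phi_type1 \<phi> n z (convex_comb M h l) - emp_phi_type1 \<phi> n z (convex_comb M h k)\<bar>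
    \<le> L * (\<Sum>j=1..M. \<bar>l j - k j\<bar>)"
proof -
  let ?d = "\<lambda>i. \<phi> (convex_comb M h l (z i)) - \<phi> (convex_comb M h k (z i))"
  have "\<bar>\<Sum>i=1..n. ?d i\<bar> \<le> (\<Sum>i=1..n. L * (\<Sum>j=1..M. \<bar>l j - k j\<bar>))"
    using assms by (intro order.trans[OF sum_abs] sum_mono surr_comb_dist) auto
  then have "\<bar>(1 / real n) * (\<Sum>i=1..n. ?d i)\<bar> \<le> L * (\<Sum>j=1..M. \<bar>l j - k j\<bar>)"
    using assms(3) by (simp add: abs_mult field_simps)
  then show ?thesis
    by (simp add: emp_phi_type1_def sum_subtractf right_diff_distrib)
qed

text \<open>Two one-sided tails, each with its own normalized surrogate, and a union bound.
  Finiteness of \<open>T\<close> makes the exceptional sets measurable.\<close>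

lemma uniform_deviation_net:
  assumes W: "prob_space W" and iid: "iid_sample W P n Z" and n: "1 \<le> n"
    and T: "finite T" "T \<noteq> {}" "T \<subseteq> simplex_supp M" and \<tau>: "0 < \<tau>"
  defines "D \<equiv> \<lambda>t \<omega>. emp_phi_type1 \<phi> n (\<lambda>i. Z i \<omega>) (convex_comb M h t) - phi_type1 \<phi> P (convex_comb M h t)"
  shows "\<exists>E\<in>sets W. 1 - 2 * (real M * exp (- (\<tau>\<^sup>2 * real n / (8 * L\<^sup>2)))) \<le> measure W E
    \<and> (\<forall>\<omega>\<in>E. \<forall>t\<in>T. \<bar>D t \<omega>\<bar> < \<tau>)"
proof -
  interpret W: prob_space W by fact
  have [measurable]: "(\<lambda>\<omega>. \<phi> (convex_comb M h t (Z i \<omega>))) \<in> borel_measurable W"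
    if "t \<in> T" "i \<in> {1..n}" for t i
    using that T(3) by (intro measurable_compose[OF iid_sample_distr_PiM(2)[OF W iid n] surr_comb_meas]) auto
  have [measurable]: "D t \<in> borel_measurable W" if "t \<in> T" for t
    unfolding D_def emp_phi_type1_def using that by measurable
  have tw: "0 \<le> t j" "(\<Sum>j=1..M. t j) = 1" if "t \<in> T" "j \<in> {1..M}" for t j
    using that T(3) by (auto simp: simplex_supp_def simplex_weights_def)
  have tw1: "(\<Sum>j=1..M. t j) = 1" if "t \<in> T" for t
    using that T(3) by (auto simp: simplex_supp_def simplex_weights_def)
  have meas_t: "(\<lambda>x. \<phi> (convex_comb M h t x)) \<in> borel_measurable P" if "t \<in> T" for t
    using that T(3) surr_comb_meas by auto
  have int_t: "integrable P (\<lambda>x. \<phi> (convex_comb M h t x))" if "t \<in> T" for t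
    using that T(3) surr_comb_integrable by auto
  let ?p = "real M * exp (- (\<tau>\<^sup>2 * real n / (8 * L\<^sup>2)))"
  have up: "measure W {\<omega> \<in> space W. \<exists>t\<in>T. \<tau> \<le> D t \<omega>} \<le> ?p"
  proof -
    \<comment> \<open>Subtracting 1 leaves the centred mean unchanged and makes the surrogate vanish
      at 0.\<close>
    have "D t \<omega> = (1 / real n) * (\<Sum>i=1..n. \<phi> (convex_comb M h t (Z i \<omega>)) - 1)
        - expectation (\<lambda>x. \<phi> (convex_comb M h t x) - 1)" if "t \<in> T" for t \<omega>
      using n int_t[OF that]
      by (simp add: D_def emp_phi_type1_def phi_type1_def prob_space sum_subtractf right_diff_distrib)
    moreover have "measure W {\<omega> \<in> space W. \<exists>t\<in>T. \<tau> \<le>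
        (1 / real n) * (\<Sum>i=1..n. \<phi> (convex_comb M h t (Z i \<omega>)) - 1)
          - expectation (\<lambda>x. \<phi> (convex_comb M h t x) - 1)}
      \<le> real (card {1..M}) * exp (- (\<tau>\<^sup>2 * real n / (8 * L\<^sup>2)))"
    proof (rule measure_sup_deviation_le[where P = P and T = T and J = "{1..M}" and F = "\<lambda>t x. \<phi> (convex_comb M h t x) - 1"
          and w = "\<lambda>t. t" and b = h and \<psi> = "\<lambda>v. \<phi> v - 1",
          OF W iid n T(1,2) finite_atLeastAtMost])
      fix x y :: real assume "- 1 \<le> x" "x \<le> y" "y \<le> 1"
      from surrogate_increment[OF surr lip this]
      show "0 \<le> \<phi> y - 1 - (\<phi> x - 1) \<and> \<phi> y - 1 - (\<phi> x - 1) \<le> L * (y - x)" by simp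
    qed (use surr meas_t tw tw1 h_meas h_bound L_pos \<tau> in \<open>simp_all add: convex_comb_def convex_surrogate_def\<close>)
    ultimately show ?thesis by (simp cong: bex_cong)
  qed
  have down: "measure W {\<omega> \<in> space W. \<exists>t\<in>T. \<tau> \<le> - D t \<omega>} \<le> ?p"
  proof -
    \<comment> \<open>The lower tail is an upper tail for the classifiers - h j and the map 1 -
      \<phi> (- v), which is again nondecreasing, L-Lipschitz and zero at 0.\<close>
    have "- D t \<omega> = (1 / real n) * (\<Sum>i=1..n. 1 - \<phi> (convex_comb M h t (Z i \<omega>)))
        - expectation (\<lambda>x. 1 - \<phi> (convex_comb M h t x))" if "t \<in> T" for t \<omega>
      using n int_t[OF that]
      by (simp add: D_def emp_phi_type1_def phi_type1_def prob_space sum_subtractf right_diff_distrib)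
    moreover have "measure W {\<omega> \<in> space W. \<exists>t\<in>T. \<tau> \<le>
        (1 / real n) * (\<Sum>i=1..n. 1 - \<phi> (convex_comb M h t (Z i \<omega>)))
          - expectation (\<lambda>x. 1 - \<phi> (convex_comb M h t x))}
      \<le> real (card {1..M}) * exp (- (\<tau>\<^sup>2 * real n / (8 * L\<^sup>2)))"
    proof (rule measure_sup_deviation_le[where P = P and T = T and J = "{1..M}" and F = "\<lambda>t x. 1 - \<phi> (convex_comb M h t x)"
          and w = "\<lambda>t. t" and b = "\<lambda>j x. - h j x" and \<psi> = "\<lambda>v. 1 - \<phi> (- v)",
          OF W iid n T(1,2) finite_atLeastAtMost])
      fix x y :: real assume "- 1 \<le> x" "x \<le> y" "y \<le> 1"
      with surrogate_increment[OF surr lip, of "- y" "- x"]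
      show "0 \<le> 1 - \<phi> (- y) - (1 - \<phi> (- x)) \<and> 1 - \<phi> (- y) - (1 - \<phi> (- x)) \<le> L * (y - x)" by simp
    qed (use surr meas_t tw tw1 h_meas h_bound L_pos \<tau> in \<open>simp_all add: convex_comb_def convex_surrogate_def sum_negf\<close>)
    ultimately show ?thesis by (simp cong: bex_cong)
  qed
  let ?A = "{\<omega> \<in> space W. \<exists>t\<in>T. \<tau> \<le> D t \<omega>}" and ?B = "{\<omega> \<in> space W. \<exists>t\<in>T. \<tau> \<le> - D t \<omega>}"
  have [measurable]: "?A \<in> sets W" "?B \<in> sets W" using T(1) by measurable
  have "1 - 2 * ?p \<le> measure W (space W - (?A \<union> ?B))"
  proof -
    have "measure W (?A \<union> ?B) \<le> measure W ?A + measure W ?B" by (rule measure_Un_le) auto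
    moreover have "measure W (space W - (?A \<union> ?B)) = 1 - measure W (?A \<union> ?B)"
      by (rule W.prob_compl) auto
    ultimately show ?thesis using up down by linarith
  qed
  moreover have "\<forall>\<omega>\<in>space W - (?A \<union> ?B). \<forall>t\<in>T. \<bar>D t \<omega>\<bar> < \<tau>"
  proof (intro ballI)
    fix \<omega> t assume \<omega>: "\<omega> \<in> space W - (?A \<union> ?B)" and t: "t \<in> T"
    have "\<not> \<tau> \<le> D t \<omega>" "\<not> \<tau> \<le> - D t \<omega>" using \<omega> t by blast+
    then show "\<bar>D t \<omega>\<bar> < \<tau>" by linarith
  qed
  moreover have "space W - (?A \<union> ?B) \<in> sets W" by simp
  ultimately show ?thesis by (intro bexI[of _ "space W - (?A \<union> ?B)"] conjI)
qed

lemma uniform_deviation: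
  assumes W: "prob_space W" and iid: "iid_sample W P n Z" and n: "1 \<le> n"
    and M: "1 \<le> M" and \<delta>: "0 < \<delta>" "\<delta> < 1"
  shows "\<exists>E\<in>sets W. 1 - \<delta> \<le> measure W E \<and> (\<forall>\<omega>\<in>E. \<forall>g\<in>Hconv M h.
    \<bar>emp_phi_type1 \<phi> n (\<lambda>i. Z i \<omega>) g - phi_type1 \<phi> P g\<bar> \<le> kappa L M \<delta> / sqrt (real n))"
proof -
  define \<kappa> where "\<kappa> = kappa L M \<delta>"
  \<comment> \<open>Half of the allowed deviation is spent at the net points, the other half on
    moving to the net.\<close>
  define \<tau> where "\<tau> = \<kappa> / (2 * sqrt (real n))"
  have ln_pos: "0 < ln (2 * real M / \<delta>)"
    using M \<delta> by (intro ln_gt_zero) (auto simp: field_simps)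
  then have \<kappa>: "0 < \<kappa>" using L_pos by (simp add: \<kappa>_def kappa_def)
  then have \<tau>: "0 < \<tau>" using n by (simp add: \<tau>_def)
  obtain T where T: "finite T" "T \<subseteq> simplex_supp M"
    \<comment> \<open>At this radius the empirical and the true error each move by at most tau /
      2.\<close>
    and net: "\<And>l. l \<in> simplex_supp M \<Longrightarrow> \<exists>t\<in>T. (\<Sum>j=1..M. \<bar>l j - t j\<bar>) < \<tau> / (2 * L)"
    using simplex_supp_finite_net[of "\<tau> / (2 * L)" M] \<tau> L_pos by auto
  have T_ne: "T \<noteq> {}" using net simplex_supp_nonempty[OF M] by blast
  \<comment> \<open>The square of kappa is 32 L^2 ln (2 M / delta), so the bounds for the two tails
    add up to exactly delta.\<close>
  have "\<tau>\<^sup>2 * real n / (8 * L\<^sup>2) = ln (2 * real M / \<delta>)"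
    using n L_pos ln_pos by (simp add: \<tau>_def \<kappa>_def kappa_def power_mult_distrib power_divide)
  then have p: "2 * (real M * exp (- (\<tau>\<^sup>2 * real n / (8 * L\<^sup>2)))) = \<delta>"
    using M \<delta> by (simp add: exp_minus)
  obtain E where E: "E \<in> sets W" "1 - \<delta> \<le> measure W E"
    "\<And>\<omega> t. \<omega> \<in> E \<Longrightarrow> t \<in> T \<Longrightarrow>
      \<bar>emp_phi_type1 \<phi> n (\<lambda>i. Z i \<omega>) (convex_comb M h t) - phi_type1 \<phi> P (convex_comb M h t)\<bar> < \<tau>"
    using uniform_deviation_net[OF W iid n T(1) T_ne T(2) \<tau>] unfolding p by blast
  have "\<bar>emp_phi_type1 \<phi> n (\<lambda>i. Z i \<omega>) g - phi_type1 \<phi> P g\<bar> \<le> \<kappa> / sqrt (real n)"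
    if \<omega>: "\<omega> \<in> E" and "g \<in> Hconv M h" for \<omega> g
  proof -
    obtain l where l: "l \<in> simplex_supp M" "g = convex_comb M h l"
      using \<open>g \<in> Hconv M h\<close> by (auto simp: Hconv_eq)
    obtain t where t: "t \<in> T" "(\<Sum>j=1..M. \<bar>l j - t j\<bar>) < \<tau> / (2 * L)" using net[OF l(1)] by auto
    then have tl: "L * (\<Sum>j=1..M. \<bar>l j - t j\<bar>) \<le> \<tau> / 2" using L_pos by (simp add: field_simps)
    have t': "t \<in> simplex_supp M" using t T by auto
    have "\<omega> \<in> space W" using \<omega> E(1) sets.sets_into_space by blast
    then have Zs: "Z i \<omega> \<in> space P" if "i \<in> {1..n}" for i
      using iid_sample_distr_PiM(2)[OF W iid n that] by (rule measurable_space[rotated])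
    have "\<bar>emp_phi_type1 \<phi> n (\<lambda>i. Z i \<omega>) g - phi_type1 \<phi> P g\<bar> \<le> 2 * \<tau>"
      using emp_phi_type1_dist[OF l(1) t' n, of "\<lambda>i. Z i \<omega>", OF Zs] phi_type1_dist[OF l(1) t']
        E(3)[OF \<omega> t(1)] tl unfolding l(2) by linarith
    then show ?thesis by (simp add: \<tau>_def)
  qed
  then show ?thesis using E(1,2) unfolding \<kappa>_def by (intro bexI[of _ E] conjI ballI)
qed

end

section \<open>The constrained empirical program\<close>

definition mix :: "real \<Rightarrow> (nat \<Rightarrow> real) \<Rightarrow> (nat \<Rightarrow> real) \<Rightarrow> nat \<Rightarrow> real" where
  "mix t l k = (\<lambda>j. (1 - t) * l j + t * k j)"

lemma mix_in_simplex_supp: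
  assumes "l \<in> simplex_supp M" "k \<in> simplex_supp M" "0 \<le> t" "t \<le> 1"
  shows "mix t l k \<in> simplex_supp M"
  using assms
  by (auto simp: simplex_supp_def simplex_weights_def mix_def sum.distrib simp flip: sum_distrib_left)

context bounded_classifiers
begin

lemma phi_type1_mix:
  assumes "l \<in> simplex_supp M" "k \<in> simplex_supp M" "0 \<le> t" "t \<le> 1"
  shows "phi_type1 \<phi> P (convex_comb M h (mix t l k))
    \<le> (1 - t) * phi_type1 \<phi> P (convex_comb M h l) + t * phi_type1 \<phi> P (convex_comb M h k)"
proof -
  have conv: "convex_on {-1..1} \<phi>" using surr by (simp add: convex_surrogate_def)
  have "phi_type1 \<phi> P (convex_comb M h (mix t l k))
    \<le> expectation (\<lambda>x. (1 - t) * \<phi> (convex_comb M h l x) + t * \<phi> (convex_comb M h k x))"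
    unfolding phi_type1_def
  proof (intro integral_mono surr_comb_integrable mix_in_simplex_supp assms)
    fix x assume x: "x \<in> space P"
    have "convex_comb M h (mix t l k) x = (1 - t) *\<^sub>R convex_comb M h l x + t *\<^sub>R convex_comb M h k x"
      by (simp add: convex_comb_def mix_def sum.distrib sum_distrib_left distrib_right mult.assoc)
    then show "\<phi> (convex_comb M h (mix t l k) x)
        \<le> (1 - t) * \<phi> (convex_comb M h l x) + t * \<phi> (convex_comb M h k x)"
      using convex_onD[OF conv assms(3,4) comb_range[OF assms(1) x] comb_range[OF assms(2) x]] by simp
  qed (use assms surr_comb_integrable in auto)
  also have "\<dots> = (1 - t) * phi_type1 \<phi> P (convex_comb M h l) + t * phi_type1 \<phi> P (convex_comb M h k)"
    using assms by (simp add: phi_type1_def surr_comb_integrable)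
  finally show ?thesis .
qed

lemma phi_type1_bounds:
  assumes "l \<in> simplex_supp M"
  shows "0 \<le> phi_type1 \<phi> P (convex_comb M h l)" "phi_type1 \<phi> P (convex_comb M h l) \<le> \<phi> 1"
proof -
  have b: "0 \<le> \<phi> (convex_comb M h l x)" "\<phi> (convex_comb M h l x) \<le> \<phi> 1" if "x \<in> space P" for x
    using surrogate_bounds[OF surr comb_range[OF assms that]] by auto
  then show "0 \<le> phi_type1 \<phi> P (convex_comb M h l)"
    unfolding phi_type1_def by (intro integral_nonneg_AE) auto
  have "phi_type1 \<phi> P (convex_comb M h l) \<le> expectation (\<lambda>_. \<phi> 1)"
    unfolding phi_type1_def using b assms by (intro integral_mono surr_comb_integrable) auto
  then show "phi_type1 \<phi> P (convex_comb M h l) \<le> \<phi> 1" by (simp add: prob_space)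
qed

text \<open>Monotonicity and \<phi> 0 = 1 give \<phi> >= 1 on [0, 1], so the surrogate dominates the
  indicator of the error event.\<close>

lemma type1_le_phi_type1:
  assumes "l \<in> simplex_supp M"
  shows "type1 P (convex_comb M h l) \<le> phi_type1 \<phi> P (convex_comb M h l)"
proof -
  let ?A = "{x \<in> space P. 0 \<le> convex_comb M h l x}"
  have A [measurable]: "?A \<in> sets P" using comb_meas[of l] by measurable
  have "type1 P (convex_comb M h l) = expectation (indicator ?A)"
    by (simp add: type1_def)
  also have "\<dots> \<le> phi_type1 \<phi> P (convex_comb M h l)"
    unfolding phi_type1_def
  proof (intro integral_mono surr_comb_integrable assms)
    show "integrable P (indicator ?A :: 'a \<Rightarrow> real)" by (simp add: emeasure_eq_measure)
    fix x assume x: "x \<in> space P"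
    have "1 \<le> \<phi> v" if "v \<in> {-1..1}" "0 \<le> v" for v
      using surr that by (auto simp: convex_surrogate_def dest: mono_onD[of _ \<phi> 0 v])
    then show "indicator ?A x \<le> \<phi> (convex_comb M h l x)"
      using comb_range[OF assms x] surrogate_bounds(1)[OF surr comb_range[OF assms x]]
      by (auto simp: indicator_def)
  qed
  finally show ?thesis .
qed

lemma phi_type1_continuous: "continuous_on (simplex_supp M) (\<lambda>l. phi_type1 \<phi> P (convex_comb M h l))"
  by (rule continuous_on_l1_lipschitz[OF phi_type1_dist])

lemma emp_phi_type1_continuous:
  assumes "1 \<le> n" "\<And>i. i \<in> {1..n} \<Longrightarrow> z i \<in> space P"
  shows "continuous_on (simplex_supp M) (\<lambda>l. emp_phi_type1 \<phi> n z (convex_comb M h l))"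
  by (rule continuous_on_l1_lipschitz[OF emp_phi_type1_dist]) (use assms in auto)

end

text \<open>Serves twice: for the population problem, so that the minimum in the claim is attained,
  and for the empirical program, so that a solution exists.\<close>

lemma compact_constrained_argmin:
  fixes f c :: "'a::t2_space \<Rightarrow> real"
  assumes "compact S" "continuous_on S f" "continuous_on S c" "k \<in> S" "c k \<le> r"
  obtains x where "x \<in> S" "c x \<le> r" "\<And>y. y \<in> S \<Longrightarrow> c y \<le> r \<Longrightarrow> f x \<le> f y"
proof -
  let ?K = "{x \<in> S. c x \<le> r}"
  have "closedin (top_of_set S) (S \<inter> c -` {..r})"
    using assms(3) by (intro continuous_closedin_preimage) auto
  moreover have "S \<inter> c -` {..r} = ?K" by auto
  ultimately have "compact ?K" using assms(1) closedin_compact by metis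
  moreover have "continuous_on ?K f" by (rule continuous_on_subset[OF assms(2)]) auto
  ultimately show thesis
    using continuous_attains_inf[of ?K f] assms(4,5) that by auto
qed

text \<open>The comparison point \<open>mix \<theta> k lm\<close> trades a little of the best constrained rule \<open>k\<close> for the
  rule \<open>lm\<close> of minimal \<open>\<phi>\<close>-type I error, just enough to make it feasible for the empirical program.\<close>

lemma constrained_erm_oracle:
  fixes a a' b b' :: "(nat \<Rightarrow> real) \<Rightarrow> real"
  assumes dev_a: "\<And>l. l \<in> simplex_supp M \<Longrightarrow> \<bar>a' l - a l\<bar> \<le> p"
    and dev_b: "\<And>l. l \<in> simplex_supp M \<Longrightarrow> \<bar>b' l - b l\<bar> \<le> q"
    and mix_a: "\<And>l k t. l \<in> simplex_supp M \<Longrightarrow> k \<in> simplex_supp M \<Longrightarrow> 0 \<le> t \<Longrightarrow> t \<le> 1 \<Longrightarrow>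
      a (mix t l k) \<le> (1 - t) * a l + t * a k"
    and mix_b: "\<And>l k t. l \<in> simplex_supp M \<Longrightarrow> k \<in> simplex_supp M \<Longrightarrow> 0 \<le> t \<Longrightarrow> t \<le> 1 \<Longrightarrow>
      b (mix t l k) \<le> (1 - t) * b l + t * b k"
    and b_bounds: "\<And>l. l \<in> simplex_supp M \<Longrightarrow> 0 \<le> b l" "\<And>l. l \<in> simplex_supp M \<Longrightarrow> b l \<le> B"
    and lm: "lm \<in> simplex_supp M" "a lm \<le> e * \<alpha>" and pos: "0 \<le> p" "0 < (1 - e) * \<alpha>" "4 * p \<le> (1 - e) * \<alpha>"
    and l: "l \<in> simplex_supp M"
    and l_min: "\<And>k. k \<in> simplex_supp M \<Longrightarrow> a' k \<le> \<alpha> - p \<Longrightarrow> b' l \<le> b' k"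
    and k: "k \<in> simplex_supp M" "a k \<le> \<alpha>"
  shows "b l - b k \<le> 2 * B * p / ((1 - e) * \<alpha>) + 2 * q"
proof -
  \<comment> \<open>The level has to drop by 2 p: one p for the stricter empirical threshold and one
    for the deviation at the mixture. Moving towards \<open>lm\<close> by t lowers it by t * ((1 -
    e) * \<alpha>).\<close>
  define t where "t = 2 * p / ((1 - e) * \<alpha>)"
  have t: "0 \<le> t" "t \<le> 1" using pos by (auto simp: t_def pos_divide_le_eq)
  have m: "mix t k lm \<in> simplex_supp M" by (intro mix_in_simplex_supp k lm t)
  have "a (mix t k lm) \<le> (1 - t) * a k + t * a lm" by (intro mix_a k lm t)
  also have "\<dots> \<le> (1 - t) * \<alpha> + t * (e * \<alpha>)" using t k lm by (intro add_mono mult_left_mono) auto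
  also have "\<dots> = \<alpha> - t * ((1 - e) * \<alpha>)" by (simp add: algebra_simps)
  also have "t * ((1 - e) * \<alpha>) = 2 * p"
  proof -
    have "(1 - e) * \<alpha> \<noteq> 0" using pos(2) by linarith
    from nonzero_eq_divide_eq[OF this] show ?thesis using t_def by blast
  qed
  finally have "a' (mix t k lm) \<le> \<alpha> - p" using dev_a[OF m] by linarith
  from l_min[OF m this] have "b' l \<le> b' (mix t k lm)" .
  moreover have "b (mix t k lm) \<le> (1 - t) * b k + t * b lm" by (intro mix_b k lm t)
  \<comment> \<open>Nonnegativity of b makes the first part no worse than \<open>b k\<close>, so the
    mixture loses at most t * B.\<close>
  moreover have "(1 - t) * b k \<le> 1 * b k" "t * b lm \<le> t * B"
    by (intro mult_right_mono mult_left_mono; use t b_bounds k lm in simp)+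
  \<comment> \<open>One q is paid at the solution and one at the mixture.\<close>
  ultimately have "b l \<le> b k + t * B + 2 * q" using dev_b[OF m] dev_b[OF l] by linarith
  then show ?thesis by (simp add: t_def mult.commute mult.left_commute)
qed

section \<open>Negated classifiers, the sample-size condition and the growth of kappa\<close>

lemma phi_type2_eq: "phi_type2 \<phi> P (convex_comb M h l) = phi_type1 \<phi> P (convex_comb M (\<lambda>j x. - h j x) l)"
  by (simp add: phi_type2_def phi_type1_def convex_comb_def sum_negf)

lemma emp_phi_type2_eq:
  "emp_phi_type2 \<phi> n z (convex_comb M h l) = emp_phi_type1 \<phi> n z (convex_comb M (\<lambda>j x. - h j x) l)"
  by (simp add: emp_phi_type2_def emp_phi_type1_def convex_comb_def sum_negf)

lemma n_zero_le_imp: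
  assumes "n_zero \<kappa> e \<alpha> \<le> n" "0 < (1 - e) * \<alpha>" "0 \<le> \<kappa>" "1 \<le> n"
  shows "4 * (\<kappa> / sqrt (real n)) \<le> (1 - e) * \<alpha>"
proof -
  \<comment> \<open>The Archimedean property supplies a witness for the \<open>LEAST\<close> in
    \<open>n_zero\<close>.\<close>
  obtain k where "(4 * \<kappa> / ((1 - e) * \<alpha>))\<^sup>2 \<le> real k" using real_arch_simple by blast
  then have "(4 * \<kappa> / ((1 - e) * \<alpha>))\<^sup>2 \<le> real (n_zero \<kappa> e \<alpha>)"
    unfolding n_zero_def by (rule LeastI)
  also have "\<dots> \<le> real n" using assms(1) by simp
  finally have "4 * \<kappa> / ((1 - e) * \<alpha>) \<le> sqrt (real n)" by (rule real_le_rsqrt)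
  then show ?thesis using assms by (simp add: field_simps)
qed

lemma kappa_nonneg: "0 \<le> L \<Longrightarrow> 1 \<le> M \<Longrightarrow> 0 < \<delta> \<Longrightarrow> \<delta> < 1 \<Longrightarrow> 0 \<le> kappa L M \<delta>"
  by (auto simp: kappa_def intro!: mult_nonneg_nonneg ln_ge_zero)

text \<open>Since ln M >= ln 2, the constant ln (2 / delta) is at most a fixed multiple of ln
  M.\<close>

lemma kappa_le:
  assumes "0 < L" "2 \<le> M" "0 < \<delta>" "\<delta> < 1"
  shows "kappa L M \<delta> \<le> 4 * sqrt 2 * L * sqrt (1 + ln (2 / \<delta>) / ln 2) * sqrt (ln (real M))"
proof -
  have "0 < ln (2 / \<delta>)" using assms by (intro ln_gt_zero) auto
  moreover have "ln 2 \<le> ln (real M)" using assms by simp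
  ultimately have "ln (2 / \<delta>) * ln 2 \<le> ln (2 / \<delta>) * ln (real M)" by (intro mult_left_mono) auto
  then have "ln (2 / \<delta>) \<le> ln (2 / \<delta>) / ln 2 * ln (real M)" by (simp add: pos_le_divide_eq)
  moreover have "ln (2 * real M / \<delta>) = ln (2 / \<delta>) + ln (real M)"
    using assms by (simp add: ln_mult ln_div)
  ultimately have "ln (2 * real M / \<delta>) \<le> (1 + ln (2 / \<delta>) / ln 2) * ln (real M)"
    by (simp add: distrib_right)
  then have "sqrt (ln (2 * real M / \<delta>)) \<le> sqrt (1 + ln (2 / \<delta>) / ln 2) * sqrt (ln (real M))"
    by (simp flip: real_sqrt_mult)
  then have "4 * sqrt 2 * L * sqrt (ln (2 * real M / \<delta>))
    \<le> 4 * sqrt 2 * L * (sqrt (1 + ln (2 / \<delta>) / ln 2) * sqrt (ln (real M)))"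
    using assms by (intro mult_left_mono) auto
  then show ?thesis by (simp add: kappa_def mult.assoc)
qed

text \<open>Positivity of (1 - e) * \<alpha> and \<open>0 \<le> excess\<close> are recorded for the
  rate: the first makes its coefficient nonnegative, the second turns the upper bound into one on
  the absolute value.\<close>

lemma np_classification_bound:
  fixes Pm Pp :: "'a measure"
  assumes W: "prob_space W" and n: "1 \<le> nm" "1 \<le> np" and M: "2 \<le> M" and \<delta>: "0 < \<delta>" "\<delta> < 1"
    and iid: "iid_sample W Pm nm Xm" "iid_sample W Pp np Xp"
    and bm: "bounded_classifiers Pm M h \<phi> L" and bp: "bounded_classifiers Pp M (\<lambda>j x. - h j x) \<phi> L"
    and \<alpha>: "0 < \<alpha>" and feas: "0 < \<epsilon>" "\<epsilon> < 1" "Hphi \<phi> Pm M h (\<epsilon> * \<alpha>) \<noteq> {}"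
    and e: "eps_bar \<phi> Pm M h \<alpha> = e" and n0: "n_zero (kappa L M \<delta>) e \<alpha> \<le> nm"
  shows "0 < (1 - e) * \<alpha> \<and> with_prob_at_least W (1 - 2 * \<delta>) (\<lambda>\<omega>.
    let sol = np_solution \<phi> (kappa L M \<delta>) \<alpha> M h nm (\<lambda>i. Xm i \<omega>) np (\<lambda>i. Xp i \<omega>) in
    (\<exists>g. sol g) \<and> (\<forall>g. sol g \<longrightarrow>
      (let excess = phi_type2 \<phi> Pp g - min_phi_type2 \<phi> Pp (Hphi \<phi> Pm M h \<alpha>) in
        type1 Pm g \<le> phi_type1 \<phi> Pm g \<and> phi_type1 \<phi> Pm g \<le> \<alpha> \<and> 0 \<le> excess \<and>
        excess \<le> 2 * \<phi> 1 * (kappa L M \<delta> / sqrt (real nm)) / ((1 - e) * \<alpha>)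
                 + 2 * (kappa L M \<delta> / sqrt (real np)))))"
proof
  interpret W: prob_space W by fact
  interpret m: bounded_classifiers Pm M h \<phi> L by fact
  interpret p: bounded_classifiers Pp M "\<lambda>j x. - h j x" \<phi> L by fact
  let ?S = "simplex_supp M"
  define a where "a l = phi_type1 \<phi> Pm (convex_comb M h l)" for l
  define b where "b l = phi_type2 \<phi> Pp (convex_comb M h l)" for l
  have a_cont: "continuous_on ?S a"
    using m.phi_type1_continuous by (simp add: a_def[abs_def])
  have b_cont: "continuous_on ?S b"
    using p.phi_type1_continuous by (simp add: b_def[abs_def] phi_type2_eq)
  define \<kappa> where "\<kappa> = kappa L M \<delta>"
  have \<kappa>: "0 \<le> \<kappa>" unfolding \<kappa>_def using M \<delta> m.L_pos by (intro kappa_nonneg) auto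
  have "?S \<noteq> {}" using M by (intro simplex_supp_nonempty) simp
  then obtain l0 where l0: "l0 \<in> ?S" "\<And>l. l \<in> ?S \<Longrightarrow> a l0 \<le> a l"
    using continuous_attains_inf[OF compact_simplex_supp _ a_cont] by blast
  \<comment> \<open>The minimizer \<open>l0\<close> decides nonemptiness at every level, so the
    least epsilon is attained and equals a l0 / \<alpha>.\<close>
  have Hphi_ne: "Hphi \<phi> Pm M h r \<noteq> {} \<longleftrightarrow> a l0 \<le> r" for r
    using l0 by (force simp: Hphi_def Hconv_eq a_def)
  have "eps_bar \<phi> Pm M h \<alpha> = a l0 / \<alpha>"
    unfolding eps_bar_def Hphi_ne
    using m.phi_type1_bounds(1)[OF l0(1)] \<alpha>
    by (intro Least_equality) (auto simp: a_def pos_divide_le_eq)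
  then have e_eq: "a l0 = e * \<alpha>" using e \<alpha> by simp
  have "a l0 \<le> \<epsilon> * \<alpha>" using feas(3) by (simp only: Hphi_ne)
  then have "e \<le> \<epsilon>" using \<alpha> by (simp add: e_eq)
  then show e_pos: "0 < (1 - e) * \<alpha>" using feas(2) \<alpha> by simp
  have pn: "4 * (\<kappa> / sqrt (real nm)) \<le> (1 - e) * \<alpha>"
    using n_zero_le_imp[OF n0 e_pos] \<kappa> n(1) by (simp add: \<kappa>_def)
  have "a l0 \<le> \<alpha>" using e_pos e_eq by (simp add: left_diff_distrib)
  then obtain k where k: "k \<in> ?S" "a k \<le> \<alpha>" and k_min: "\<And>l. l \<in> ?S \<Longrightarrow> a l \<le> \<alpha> \<Longrightarrow> b k \<le> b l"
    using compact_constrained_argmin[OF compact_simplex_supp b_cont a_cont l0(1)] by metis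
  have min_eq: "min_phi_type2 \<phi> Pp (Hphi \<phi> Pm M h \<alpha>) = b k"
    unfolding min_phi_type2_def using k k_min
    by (intro Least_equality) (auto simp: Hphi_def Hconv_eq a_def b_def)
  obtain Em where Em: "Em \<in> sets W" "1 - \<delta> \<le> measure W Em"
    and dev_m: "\<And>\<omega> g. \<omega> \<in> Em \<Longrightarrow> g \<in> Hconv M h \<Longrightarrow>
      \<bar>emp_phi_type1 \<phi> nm (\<lambda>i. Xm i \<omega>) g - phi_type1 \<phi> Pm g\<bar> \<le> \<kappa> / sqrt (real nm)"
    using m.uniform_deviation[OF W iid(1) n(1) _ \<delta>] M unfolding \<kappa>_def by auto
  obtain Ep where Ep: "Ep \<in> sets W" "1 - \<delta> \<le> measure W Ep"
    and dev_p: "\<And>\<omega> g. \<omega> \<in> Ep \<Longrightarrow> g \<in> Hconv M (\<lambda>j x. - h j x) \<Longrightarrow>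
      \<bar>emp_phi_type1 \<phi> np (\<lambda>i. Xp i \<omega>) g - phi_type1 \<phi> Pp g\<bar> \<le> \<kappa> / sqrt (real np)"
    using p.uniform_deviation[OF W iid(2) n(2) _ \<delta>] M unfolding \<kappa>_def by auto
  \<comment> \<open>Inclusion-exclusion rather than a product of probabilities, because the two
    samples may be dependent.\<close>
  have "1 - 2 * \<delta> \<le> measure W (Em \<inter> Ep)"
  proof -
    have "measure W (Em \<union> Ep) = measure W Em + measure W Ep - measure W (Em \<inter> Ep)"
      using Em(1) Ep(1) by (intro measure_Un3) (auto simp: W.fmeasurable_eq_sets)
    then show ?thesis using Em(2) Ep(2) W.prob_le_1[of "Em \<union> Ep"] by linarith
  qed
  moreover have "let sol = np_solution \<phi> (kappa L M \<delta>) \<alpha> M h nm (\<lambda>i. Xm i \<omega>) np (\<lambda>i. Xp i \<omega>) in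
    (\<exists>g. sol g) \<and> (\<forall>g. sol g \<longrightarrow>
      (let excess = phi_type2 \<phi> Pp g - min_phi_type2 \<phi> Pp (Hphi \<phi> Pm M h \<alpha>) in
        type1 Pm g \<le> phi_type1 \<phi> Pm g \<and> phi_type1 \<phi> Pm g \<le> \<alpha> \<and> 0 \<le> excess \<and>
        excess \<le> 2 * \<phi> 1 * (kappa L M \<delta> / sqrt (real nm)) / ((1 - e) * \<alpha>)
                 + 2 * (kappa L M \<delta> / sqrt (real np))))"
    if \<omega>: "\<omega> \<in> Em \<inter> Ep" for \<omega>
  proof -
    define a' where "a' l = emp_phi_type1 \<phi> nm (\<lambda>i. Xm i \<omega>) (convex_comb M h l)" for l
    define b' where "b' l = emp_phi_type2 \<phi> np (\<lambda>i. Xp i \<omega>) (convex_comb M h l)" for l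
    define sol where "sol = np_solution \<phi> \<kappa> \<alpha> M h nm (\<lambda>i. Xm i \<omega>) np (\<lambda>i. Xp i \<omega>)"
    have "\<omega> \<in> space W" using \<omega> Em(1) sets.sets_into_space by blast
    then have sp: "i \<in> {1..nm} \<Longrightarrow> Xm i \<omega> \<in> space Pm" "i \<in> {1..np} \<Longrightarrow> Xp i \<omega> \<in> space Pp" for i
      using iid_sample_distr_PiM(2)[OF W iid(1) n(1)] iid_sample_distr_PiM(2)[OF W iid(2) n(2)]
      by (auto intro: measurable_space)
    have a'_cont: "continuous_on ?S a'"
      using m.emp_phi_type1_continuous[OF n(1), of "\<lambda>i. Xm i \<omega>"] sp(1) by (simp add: a'_def[abs_def])
    have b'_cont: "continuous_on ?S b'"
      using p.emp_phi_type1_continuous[OF n(2), of "\<lambda>i. Xp i \<omega>"] sp(2)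
      by (simp add: b'_def[abs_def] emp_phi_type2_eq)
    have dev_a: "\<bar>a' l - a l\<bar> \<le> \<kappa> / sqrt (real nm)" if "l \<in> ?S" for l
      using dev_m[of \<omega> "convex_comb M h l"] \<omega> that by (auto simp: a'_def a_def Hconv_eq)
    have dev_b: "\<bar>b' l - b l\<bar> \<le> \<kappa> / sqrt (real np)" if "l \<in> ?S" for l
      using dev_p[of \<omega> "convex_comb M (\<lambda>j x. - h j x) l"] \<omega> that
      by (auto simp: b'_def b_def Hconv_eq phi_type2_eq emp_phi_type2_eq)
    have sol_iff: "sol g \<longleftrightarrow> (\<exists>l\<in>?S. g = convex_comb M h l \<and> a' l \<le> \<alpha> - \<kappa> / sqrt (real nm) \<and>
        (\<forall>k\<in>?S. a' k \<le> \<alpha> - \<kappa> / sqrt (real nm) \<longrightarrow> b' l \<le> b' k))" for g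
      unfolding sol_def np_solution_def is_arg_min_def Hconv_eq a'_def b'_def by (auto simp: not_less)
    \<comment> \<open>The empirical constraint set is nonempty: \<open>a l0\<close> lies at least 4
      kappa / sqrt nm below \<alpha>, and the deviation uses up one of these four units.\<close>
    have "a' l0 \<le> \<alpha> - \<kappa> / sqrt (real nm)"
      using dev_a[OF l0(1)] pn \<kappa> n(1) e_eq by (simp add: left_diff_distrib abs_le_iff)
    then obtain l1 where "l1 \<in> ?S" "a' l1 \<le> \<alpha> - \<kappa> / sqrt (real nm)"
      "\<And>k. k \<in> ?S \<Longrightarrow> a' k \<le> \<alpha> - \<kappa> / sqrt (real nm) \<Longrightarrow> b' l1 \<le> b' k"
      using compact_constrained_argmin[OF compact_simplex_supp b'_cont a'_cont l0(1)] by metis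
    then have ex: "\<exists>g. sol g" unfolding sol_iff by auto
    have bd: "type1 Pm g \<le> phi_type1 \<phi> Pm g" "phi_type1 \<phi> Pm g \<le> \<alpha>" "0 \<le> phi_type2 \<phi> Pp g - b k"
      "phi_type2 \<phi> Pp g - b k \<le> 2 * \<phi> 1 * (\<kappa> / sqrt (real nm)) / ((1 - e) * \<alpha>) + 2 * (\<kappa> / sqrt (real np))"
      if "sol g" for g
    proof -
      obtain l where l: "l \<in> ?S" "g = convex_comb M h l" "a' l \<le> \<alpha> - \<kappa> / sqrt (real nm)"
        and l_min: "\<And>k. k \<in> ?S \<Longrightarrow> a' k \<le> \<alpha> - \<kappa> / sqrt (real nm) \<Longrightarrow> b' l \<le> b' k"
        using \<open>sol g\<close> unfolding sol_iff by blast
      show "type1 Pm g \<le> phi_type1 \<phi> Pm g" unfolding l(2) by (rule m.type1_le_phi_type1[OF l(1)])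
      \<comment> \<open>The margin in the empirical constraint absorbs the deviation. The solution
        is therefore a competitor in the class defining the minimum, which also makes the excess
        nonnegative.\<close>
      have al: "a l \<le> \<alpha>" using dev_a[OF l(1)] l(3) by linarith
      then show "phi_type1 \<phi> Pm g \<le> \<alpha>" by (simp add: l(2) a_def)
      show "0 \<le> phi_type2 \<phi> Pp g - b k" using k_min[OF l(1) al] by (simp add: l(2) b_def)
      have "b l - b k \<le> 2 * \<phi> 1 * (\<kappa> / sqrt (real nm)) / ((1 - e) * \<alpha>) + 2 * (\<kappa> / sqrt (real np))"
      proof (rule constrained_erm_oracle[where a = a and a' = a' and b = b and b' = b' and M = M and lm = l0
            and p = "\<kappa> / sqrt (real nm)" and q = "\<kappa> / sqrt (real np)" and B = "\<phi> 1" and e = e and \<alpha> = \<alpha> and l = l and k = k])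
        show "a (mix t l k) \<le> (1 - t) * a l + t * a k" if "l \<in> ?S" "k \<in> ?S" "0 \<le> t" "t \<le> 1" for l k t
          unfolding a_def by (rule m.phi_type1_mix[OF that])
        show "b (mix t l k) \<le> (1 - t) * b l + t * b k" if "l \<in> ?S" "k \<in> ?S" "0 \<le> t" "t \<le> 1" for l k t
          unfolding b_def phi_type2_eq by (rule p.phi_type1_mix[OF that])
        show "0 \<le> b l" "b l \<le> \<phi> 1" if "l \<in> ?S" for l
          using p.phi_type1_bounds[OF that] by (auto simp: b_def phi_type2_eq)
      qed (use dev_a dev_b l0 l l_min k e_eq e_pos pn \<kappa> in auto)
      then show "phi_type2 \<phi> Pp g - b k
        \<le> 2 * \<phi> 1 * (\<kappa> / sqrt (real nm)) / ((1 - e) * \<alpha>) + 2 * (\<kappa> / sqrt (real np))"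
        by (simp add: l(2) b_def)
    qed
    show ?thesis
      using ex bd unfolding Let_def min_eq sol_def \<kappa>_def by blast
  qed
  ultimately show "with_prob_at_least W (1 - 2 * \<delta>) (\<lambda>\<omega>.
    let sol = np_solution \<phi> (kappa L M \<delta>) \<alpha> M h nm (\<lambda>i. Xm i \<omega>) np (\<lambda>i. Xp i \<omega>) in
    (\<exists>g. sol g) \<and> (\<forall>g. sol g \<longrightarrow>
      (let excess = phi_type2 \<phi> Pp g - min_phi_type2 \<phi> Pp (Hphi \<phi> Pm M h \<alpha>) in
        type1 Pm g \<le> phi_type1 \<phi> Pm g \<and> phi_type1 \<phi> Pm g \<le> \<alpha> \<and> 0 \<le> excess \<and>
        excess \<le> 2 * \<phi> 1 * (kappa L M \<delta> / sqrt (real nm)) / ((1 - e) * \<alpha>)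
                 + 2 * (kappa L M \<delta> / sqrt (real np)))))"
    unfolding with_prob_at_least_def using Em(1) Ep(1)
    by (intro bexI[of _ "Em \<inter> Ep"] conjI ballI) auto
qed

section \<open>The two class distributions and the final bounds\<close>

lemma (in np_setting) bounded_classifiers_class_law:
  assumes "iid_sample W (class_law Q DD X Y y) n Z" "1 \<le> n"
    and "convex_surrogate \<phi>" "L-lipschitz_on {-1..1} \<phi>" "0 < L"
  shows "bounded_classifiers (class_law Q DD X Y y) M h \<phi> L"
    and "bounded_classifiers (class_law Q DD X Y y) M (\<lambda>j x. - h j x) \<phi> L"
proof -
  \<comment> \<open>Total mass 1 is read off from the sample, whose observations have this
    law.\<close>
  interpret P: prob_space "class_law Q DD X Y y"
    using iid_sample_distr_PiM(3)[OF data.prob_space_axioms assms(1,2)] .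
  have sets: "sets (class_law Q DD X Y y) = sets (restrict_space borel DD)"
    by (simp add: class_law_def)
  have sp: "space (class_law Q DD X Y y) = DD"
    by (simp add: class_law_def space_restrict_space)
  have meas: "h j \<in> borel_measurable (class_law Q DD X Y y)" if "j \<in> {1..M}" for j
    using classifier_measurable[OF that] by (simp add: measurable_cong_sets[OF sets refl])
  have bnd: "\<bar>h j x\<bar> \<le> 1" if "j \<in> {1..M}" "x \<in> DD" for j x
    using classifier_range[OF that] by auto
  show "bounded_classifiers (class_law Q DD X Y y) M h \<phi> L"
    "bounded_classifiers (class_law Q DD X Y y) M (\<lambda>j x. - h j x) \<phi> L"
    by unfold_locales (use meas bnd assms sp in auto)
qed

theorem theorem4p2:
  fixes \<delta> \<alpha> L \<epsilon>bar :: real and \<phi> :: "real \<Rightarrow> real"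
  assumes "0 < \<delta>" "\<delta> < 1" "0 < \<alpha>" "\<alpha> < 1" "0 < L"
    and "convex_surrogate \<phi>" and "L-lipschitz_on {-1..1} \<phi>"
  shows "\<exists>C N. \<forall>(Q :: 'q measure) (W :: 'w measure) (DD :: (real^'d) set) X Y M h nm np Xm Xp.
    np_setting Q W DD X Y M h nm np Xm Xp \<longrightarrow>
    (let Pm = class_law Q DD X Y (-1); Pp = class_law Q DD X Y 1; \<kappa> = kappa L M \<delta> in
      (\<exists>\<epsilon>. 0 < \<epsilon> \<and> \<epsilon> < 1 \<and> Hphi \<phi> Pm M h (\<epsilon> * \<alpha>) \<noteq> {}) \<longrightarrow>
      eps_bar \<phi> Pm M h \<alpha> = \<epsilon>bar \<longrightarrow>
      n_zero \<kappa> \<epsilon>bar \<alpha> \<le> nm \<longrightarrow>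
      with_prob_at_least W (1 - 2 * \<delta>) (\<lambda>\<omega>.
        let sol = np_solution \<phi> \<kappa> \<alpha> M h nm (\<lambda>i. Xm i \<omega>) np (\<lambda>i. Xp i \<omega>) in
        (\<exists>g. sol g) \<and>
        (\<forall>g. sol g \<longrightarrow>
          (let excess = phi_type2 \<phi> Pp g - min_phi_type2 \<phi> Pp (Hphi \<phi> Pm M h \<alpha>) in
            type1 Pm g \<le> phi_type1 \<phi> Pm g \<and> phi_type1 \<phi> Pm g \<le> \<alpha> \<and>
            excess \<le> 4 * \<phi> 1 * \<kappa> / ((1 - \<epsilon>bar) * \<alpha> * sqrt (real nm)) + 2 * \<kappa> / sqrt (real np) \<and>
            (N \<le> M \<and> N \<le> nm \<and> N \<le> np \<longrightarrow>
              \<bar>excess\<bar> \<le> C * (sqrt (ln (real M) / real nm) + sqrt (ln (real M) / real np)))))))"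
proof -
  \<comment> \<open>K bounds kappa / sqrt (ln M) for all M >= 2, and c is the coefficient of kappa /
    sqrt nm in the error bound. Neither depends on M, the sample sizes or the distributions, so the
    constant of the rate can be fixed before them.\<close>
  define K where "K = 4 * sqrt 2 * L * sqrt (1 + ln (2 / \<delta>) / ln 2)"
  define c where "c = 2 * \<phi> 1 / ((1 - \<epsilon>bar) * \<alpha>)"
  have \<phi>1: "0 \<le> \<phi> 1" using surrogate_bounds(1)[OF assms(6), of 1] by simp
  have main: "with_prob_at_least W (1 - 2 * \<delta>) (\<lambda>\<omega>.
        let sol = np_solution \<phi> \<kappa> \<alpha> M h nm (\<lambda>i. Xm i \<omega>) np (\<lambda>i. Xp i \<omega>) in
        (\<exists>g. sol g) \<and>
        (\<forall>g. sol g \<longrightarrow>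
          (let excess = phi_type2 \<phi> Pp g - min_phi_type2 \<phi> Pp (Hphi \<phi> Pm M h \<alpha>) in
            type1 Pm g \<le> phi_type1 \<phi> Pm g \<and> phi_type1 \<phi> Pm g \<le> \<alpha> \<and>
            excess \<le> 4 * \<phi> 1 * \<kappa> / ((1 - \<epsilon>bar) * \<alpha> * sqrt (real nm)) + 2 * \<kappa> / sqrt (real np) \<and>
            (0 \<le> M \<and> 0 \<le> nm \<and> 0 \<le> np \<longrightarrow>
              \<bar>excess\<bar> \<le> (c + 2) * K * (sqrt (ln (real M) / real nm) + sqrt (ln (real M) / real np))))))"
    if np: "np_setting Q W DD X Y M h nm np Xm Xp"
      and Pm: "Pm = class_law Q DD X Y (-1)" and Pp: "Pp = class_law Q DD X Y 1" and \<kappa>_def: "\<kappa> = kappa L M \<delta>"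
      and feas: "0 < \<epsilon>" "\<epsilon> < 1" "Hphi \<phi> Pm M h (\<epsilon> * \<alpha>) \<noteq> {}"
      and e: "eps_bar \<phi> Pm M h \<alpha> = \<epsilon>bar" and n0: "n_zero \<kappa> \<epsilon>bar \<alpha> \<le> nm"
    for Q :: "'q measure" and W :: "'w measure" and DD :: "(real^'d) set" and X Y M h nm np Xm Xp Pm Pp \<kappa> \<epsilon>
  proof -
    interpret np_setting Q W DD X Y M h nm np Xm Xp by fact
    have bound: "0 < (1 - \<epsilon>bar) * \<alpha> \<and> with_prob_at_least W (1 - 2 * \<delta>) (\<lambda>\<omega>.
      let sol = np_solution \<phi> \<kappa> \<alpha> M h nm (\<lambda>i. Xm i \<omega>) np (\<lambda>i. Xp i \<omega>) in
      (\<exists>g. sol g) \<and> (\<forall>g. sol g \<longrightarrow>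
        (let excess = phi_type2 \<phi> Pp g - min_phi_type2 \<phi> Pp (Hphi \<phi> Pm M h \<alpha>) in
          type1 Pm g \<le> phi_type1 \<phi> Pm g \<and> phi_type1 \<phi> Pm g \<le> \<alpha> \<and> 0 \<le> excess \<and>
          excess \<le> 2 * \<phi> 1 * (\<kappa> / sqrt (real nm)) / ((1 - \<epsilon>bar) * \<alpha>) + 2 * (\<kappa> / sqrt (real np)))))"
      unfolding \<kappa>_def Pm Pp
      by (rule np_classification_bound[OF data.prob_space_axioms sample_sizes M_ge_2 assms(1,2)
            sample_minus sample_plus bounded_classifiers_class_law(1)[OF sample_minus sample_sizes(1) assms(6,7,5)]
            bounded_classifiers_class_law(2)[OF sample_plus sample_sizes(2) assms(6,7,5)] assms(3)
            feas[unfolded Pm] e[unfolded Pm] n0[unfolded \<kappa>_def]])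
    have \<kappa>: "0 \<le> \<kappa>" "\<kappa> \<le> K * sqrt (ln (real M))"
      using kappa_nonneg[of L M \<delta>] kappa_le[of L M \<delta>] assms M_ge_2 by (auto simp: \<kappa>_def K_def)
    have c: "0 \<le> c" using bound \<phi>1 by (simp add: c_def)
    let ?r = "2 * \<phi> 1 * (\<kappa> / sqrt (real nm)) / ((1 - \<epsilon>bar) * \<alpha>) + 2 * (\<kappa> / sqrt (real np))"
    have r: "?r = c * (\<kappa> / sqrt (real nm)) + 2 * (\<kappa> / sqrt (real np))"
      by (simp add: c_def)
    have r1: "?r \<le> 4 * \<phi> 1 * \<kappa> / ((1 - \<epsilon>bar) * \<alpha> * sqrt (real nm)) + 2 * \<kappa> / sqrt (real np)"
    proof -
      \<comment> \<open>The comparison argument yields the coefficient 2 * \<phi> 1, half of the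
        stated one, so doubling a nonnegative term suffices.\<close>
      define u v where "u = c * (\<kappa> / sqrt (real nm))" and "v = \<kappa> / sqrt (real np)"
      have eqs: "4 * \<phi> 1 * \<kappa> / ((1 - \<epsilon>bar) * \<alpha> * sqrt (real nm)) = 2 * u" "2 * \<kappa> / sqrt (real np) = 2 * v"
        by (simp_all add: c_def u_def v_def)
      have "0 \<le> u" using c \<kappa> by (simp add: u_def)
      then have "u + 2 * v \<le> 2 * u + 2 * v" by simp
      then show ?thesis unfolding r eqs by (simp only: u_def v_def)
    qed
    have r2: "?r \<le> (c + 2) * K * (sqrt (ln (real M) / real nm) + sqrt (ln (real M) / real np))"
    proof -
      have "\<kappa> / sqrt (real n) \<le> K * sqrt (ln (real M) / real n)" for n
        using divide_right_mono[OF \<kappa>(2), of "sqrt (real n)"] by (simp add: real_sqrt_divide)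
      then have "?r \<le> c * (K * sqrt (ln (real M) / real nm)) + 2 * (K * sqrt (ln (real M) / real np))"
        unfolding r using c by (intro add_mono mult_left_mono) auto
      also have "\<dots> \<le> (c + 2) * (K * sqrt (ln (real M) / real nm)) + (c + 2) * (K * sqrt (ln (real M) / real np))"
      proof -
        have "0 < ln (2 / \<delta>)" using assms by (intro ln_gt_zero) auto
        then have "0 \<le> K" using assms(5) by (simp add: K_def)
        then show ?thesis using c M_ge_2 by (intro add_mono mult_right_mono) auto
      qed
      finally show ?thesis by (simp add: distrib_left mult.assoc)
    qed
    show ?thesis
    proof -
      obtain E where E: "E \<in> sets W" "1 - 2 * \<delta> \<le> measure W E"
        and sol: "\<And>\<omega>. \<omega> \<in> E \<Longrightarrow> \<exists>g. np_solution \<phi> \<kappa> \<alpha> M h nm (\<lambda>i. Xm i \<omega>) np (\<lambda>i. Xp i \<omega>) g"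
        and ex: "\<And>\<omega> g. \<omega> \<in> E \<Longrightarrow> np_solution \<phi> \<kappa> \<alpha> M h nm (\<lambda>i. Xm i \<omega>) np (\<lambda>i. Xp i \<omega>) g \<Longrightarrow>
          type1 Pm g \<le> phi_type1 \<phi> Pm g \<and> phi_type1 \<phi> Pm g \<le> \<alpha> \<and>
          0 \<le> phi_type2 \<phi> Pp g - min_phi_type2 \<phi> Pp (Hphi \<phi> Pm M h \<alpha>) \<and>
          phi_type2 \<phi> Pp g - min_phi_type2 \<phi> Pp (Hphi \<phi> Pm M h \<alpha>) \<le> ?r"
        using bound unfolding with_prob_at_least_def Let_def by blast
      show ?thesis
        unfolding with_prob_at_least_def Let_def
      proof (intro bexI[of _ E] conjI ballI allI impI)
        fix \<omega> g assume "\<omega> \<in> E" "np_solution \<phi> \<kappa> \<alpha> M h nm (\<lambda>i. Xm i \<omega>) np (\<lambda>i. Xp i \<omega>) g"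
        note x = ex[OF this]
        show "type1 Pm g \<le> phi_type1 \<phi> Pm g" "phi_type1 \<phi> Pm g \<le> \<alpha>" using x by auto
        show "phi_type2 \<phi> Pp g - min_phi_type2 \<phi> Pp (Hphi \<phi> Pm M h \<alpha>)
          \<le> 4 * \<phi> 1 * \<kappa> / ((1 - \<epsilon>bar) * \<alpha> * sqrt (real nm)) + 2 * \<kappa> / sqrt (real np)"
          using x r1 by linarith
        show "\<bar>phi_type2 \<phi> Pp g - min_phi_type2 \<phi> Pp (Hphi \<phi> Pm M h \<alpha>)\<bar>
          \<le> (c + 2) * K * (sqrt (ln (real M) / real nm) + sqrt (ln (real M) / real np))"
          using x r2 by linarith
      qed (use E sol in auto)
    qed
  qed
  \<comment> \<open>The threshold N is 0: the estimate of kappa by sqrt (ln M) already holds from M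
    = 2 on.\<close>
  show ?thesis
    by (rule exI[of _ "(c + 2) * K"], rule exI[of _ 0], unfold Let_def, intro allI impI)
       (elim exE conjE, rule main[unfolded Let_def, OF _ refl refl refl])
qed

end
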